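(* Let $Y$ be a Markov chain that takes values in a Polish space $\mathcal X$ and has a $\sigma$-finite invariant Borel measure $\mu$. Then there exists a Markov chain $\hat Y$ with values in $\mathcal X$ that is dual to $Y$ relative to $\mu$. Furthermore, let $A\in\mathcal B(\mathcal X)$ be a set such that $$\mathbb P_{\mu_A}(\tau_{A^c}(Y)=\infty)=\mathbb P_{\mu_{A^c}}(\tau_A(Y)=\infty)=\hat{\mathbb P}_{\mu_A}(\tau_{A^c}(\hat Y)=\infty)=\hat{\mathbb P}_{\mu_{A^c}}(\tau_A(\hat Y)=\infty)=0 .$$ Then the measures $$\mu_A^{entr}:=\int_{A^c}\mathbb P_x(Y_1\in\cdot)\,\mu(dx)\ \text{ on }A\qquad\text{and}\qquad \mu_{A^c}^{exit}(dx):=\mathbb P_x(Y_1\in A)\,\mu(dx)\ \text{ on }A^c$$ are proper and invariant for the entrance chain $Y^{\rangle A}$ and the exit chain $Y^{A^c\rangle}$, respectively; and we have $$\mu_A^{entr}(dx)=\hat P(x,A^c)\,\mu(dx),\qquad x\in A,$$ where $\hat P$ denotes the transition kernel of $\hat Y$. Moreover, $$\mu=\mathbb E_{\mu_A^{entr}}\Bigl[\sum_{k=0}^{T_1^{\rangle A}-1}\mathbf 1(Y_k\in\cdot)\Bigr].$$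
   Context: Markov chains. All Markov chains are time-homogeneous; $\mathcal F=\mathcal B(\mathcal X)$. $Y=(Y_n)_{n\ge 0}$ has a probability transition kernel $P$; $\mathbb P_x$ denotes the law under which $Y$ is a Markov chain with kernel $P$ and $\mathbb P_x(Y_0=x)=1$; $\hat{\mathbb P}_x$ denotes the analogous law for $\hat Y$. For $A\in\mathcal F$, $\mathcal F_A:=\{B\subset A: B\in\mathcal F\}$, and $\mu_A$ is the restriction of $\mu$ to $\mathcal F_A$. For a (possibly infinite) measure $\nu$ on $(A,\mathcal F_A)$, $\mathbb P_\nu:=\int_A\mathbb P_x(\cdot)\,\nu(dx)$ (similarly $\hat{\mathbb P}_\nu$), and $\mathbb E_\nu$ is the integral with respect to $\mathbb P_\nu$. A measure $\nu$ on $(A,\mathcal F_A)$ is invariant for a chain with kernel $K$ if $\int_A K(x,B)\,\nu(dx)=\nu(B)$ for every $B\in\mathcal F_A$. $\tau_B(Y):=\inf\{n\ge 1: Y_n\in B\}$; $\inf\varnothing:=\infty$. Duality. Two chains with kernels $P,\hat P$ are dual relative to a $\sigma$-finite measure $\mu$ if $\mu(dx)P(x,dy)=\mu(dy)\hat P(y,dx)$ as measures on $\mathcal X\times\mathcal X$. Entrance and exit chains. $T_0^{\rangle A}:=0$ and $T_n^{\rangle A}:=\inf\{k>T_{n-1}^{\rangle A}: Y_{k-1}\in A^c, Y_k\in A\}$ for $n\ge1$. Put $Y_n^{\rangle A}:=Y_{T_n^{\rangle A}}$, $Y_n^{A^c\rangle}:=Y_{T_n^{\rangle A}-1}$ for $n\ge1$,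 where $Y_\infty:=\dagger\notin\mathcal X$ is a cemetery state. The entrance chain $Y^{\rangle A}=(Y_n^{\rangle A})_{n\ge1}$ is a Markov chain on $A\cup\{\dagger\}$ with kernel $P_A^{entr}(x,dy)=\mathbb P_x(Y_1^{\rangle A}\in dy)$, $x\in A$. The exit chain $Y^{A^c\rangle}=(Y_n^{A^c\rangle})_{n\ge1}$ is a Markov chain on $A^c\cup\{\dagger\}$ with kernel $P_{A^c}^{exit}(x,dy)=\int_A\mathbb P_z(Y_1^{A^c\rangle}\in dy)\,\mathbb P_x(Y_1\in dz\mid Y_1\in A)$ for $x\in A^c_{ex}:=\{x\in A^c:\mathbb P_x(Y_1\in A)>0\}$, and $P_{A^c}^{exit}(x,\{\dagger\})=1$ for $x\in A^c\setminus A^c_{ex}$. Both chains are absorbed at $\dagger$. Let $N_A:=\{x\in\mathcal X:\mathbb P_x(Y_k\in A\text{ infinitely often and }Y_k\in A^c\text{ infinitely often})=1\}$. A measure $\nu$ on $A$ is proper for $Y^{\rangle A}$ if $\nu(A\setminus N_A)=0$; a measure $\nu$ on $A^c$ is proper for $Y^{A^c\rangle}$ if $\nu(A^c\setminus(A^c_{ex}\cap N_A))=0$. *)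

theory Defs
  imports "HOL-Probability.Probability"
begin

text \<open>The Polish state space is a type of class \<^class>\<open>polish_space\<close> with its Borel
  sigma-algebra; paths are functions on the natural numbers with the product sigma-algebra.\<close>

abbreviation path_space :: "(nat \<Rightarrow> 'a::topological_space) measure" where
  "path_space \<equiv> PiM UNIV (\<lambda>_. borel)"

definition transition_kernel :: "('a::topological_space \<Rightarrow> 'a measure) \<Rightarrow> bool" where
  "transition_kernel P \<longleftrightarrow> P \<in> borel \<rightarrow>\<^sub>M prob_algebra borel"

text \<open>\<open>chain_law P x\<close> is the law of the Markov chain with kernel \<open>P\<close> started at \<open>x\<close>, constructed by
  the Ionescu-Tulcea theorem: \<open>Y\<^sub>0\<close> has law \<open>return borel x\<close>, and given the path before time
  \<open>Suc n\<close> the law of \<open>Y\<close> at time \<open>Suc n\<close> is \<open>P\<close> applied to the state at time \<open>n\<close>.\<close>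

definition chain_step ::
  "('a::topological_space \<Rightarrow> 'a measure) \<Rightarrow> 'a \<Rightarrow> nat \<Rightarrow> (nat \<Rightarrow> 'a) \<Rightarrow> 'a measure" where
  "chain_step P x n \<omega> = (case n of 0 \<Rightarrow> return borel x | Suc m \<Rightarrow> P (\<omega> m))"

definition chain_law ::
  "('a::topological_space \<Rightarrow> 'a measure) \<Rightarrow> 'a \<Rightarrow> (nat \<Rightarrow> 'a) measure" where
  "chain_law P x =
     projective_family.lim UNIV (Ionescu_Tulcea.CI (chain_step P x) (\<lambda>_. borel)) (\<lambda>_. borel)"

text \<open>The initial measure \<open>\<nu>\<close> below need not be finite, and it may live on a Borel subset
  \<open>space \<nu>\<close> of the state space; a measure on \<open>A\<close> is one with the sigma-algebra
  \<open>sets (restrict_space borel A)\<close>.\<close>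

definition chain_law_from ::
  "('a::topological_space \<Rightarrow> 'a measure) \<Rightarrow> 'a measure \<Rightarrow> (nat \<Rightarrow> 'a) measure" where
  "chain_law_from P \<nu> =
     measure_of (space path_space) (sets path_space) (\<lambda>E. \<integral>\<^sup>+x. emeasure (chain_law P x) E \<partial>\<nu>)"

text \<open>The kernel is given as a set function, so that the notion also applies to a kernel with
  a cemetery state, restricted to the proper states.\<close>

definition invariant_measure :: "('a \<Rightarrow> 'a set \<Rightarrow> ennreal) \<Rightarrow> 'a measure \<Rightarrow> bool" where
  "invariant_measure K \<nu> \<longleftrightarrow> (\<forall>B\<in>sets \<nu>. (\<integral>\<^sup>+x. K x B \<partial>\<nu>) = emeasure \<nu> B)"

text \<open>\<open>\<mu>(dx) P(x,dy) = \<mu>(dy) P'(y,dx)\<close> as measures on the product space.\<close>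

definition dual_kernels ::
  "'a::topological_space measure \<Rightarrow> ('a \<Rightarrow> 'a measure) \<Rightarrow> ('a \<Rightarrow> 'a measure) \<Rightarrow> bool" where
  "dual_kernels \<mu> P P' \<longleftrightarrow>
     (\<forall>E\<in>sets (borel \<Otimes>\<^sub>M borel).
        (\<integral>\<^sup>+x. emeasure (P x) {y. (x, y) \<in> E} \<partial>\<mu>) = (\<integral>\<^sup>+y. emeasure (P' y) {x. (x, y) \<in> E} \<partial>\<mu>))"

definition hit_time :: "'a set \<Rightarrow> (nat \<Rightarrow> 'a) \<Rightarrow> enat" where
  "hit_time B \<omega> = Inf {enat n | n. n \<ge> 1 \<and> \<omega> n \<in> B}"

primrec entr_time :: "'a set \<Rightarrow> nat \<Rightarrow> (nat \<Rightarrow> 'a) \<Rightarrow> enat" where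
  "entr_time A 0 \<omega> = 0"
| "entr_time A (Suc n) \<omega> =
     Inf {enat k | k. enat k > entr_time A n \<omega> \<and> \<omega> (k - 1) \<notin> A \<and> \<omega> k \<in> A}"

text \<open>The cemetery state is \<^const>\<open>None\<close>. Both chains are indexed by \<open>n \<ge> 1\<close>.\<close>

definition entr_chain :: "'a set \<Rightarrow> nat \<Rightarrow> (nat \<Rightarrow> 'a) \<Rightarrow> 'a option" where
  "entr_chain A n \<omega> = (case entr_time A n \<omega> of enat k \<Rightarrow> Some (\<omega> k) | \<infinity> \<Rightarrow> None)"

definition exit_chain :: "'a set \<Rightarrow> nat \<Rightarrow> (nat \<Rightarrow> 'a) \<Rightarrow> 'a option" where
  "exit_chain A n \<omega> = (case entr_time A n \<omega> of enat k \<Rightarrow> Some (\<omega> (k - 1)) | \<infinity> \<Rightarrow> None)"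

definition cemetery_space :: "'a::topological_space set \<Rightarrow> 'a option measure" where
  "cemetery_space S =
     sigma (insert None (Some ` S)) {B. B \<subseteq> insert None (Some ` S) \<and> Some -` B \<in> sets borel}"

definition entr_kernel ::
  "('a::topological_space \<Rightarrow> 'a measure) \<Rightarrow> 'a set \<Rightarrow> 'a option \<Rightarrow> 'a option measure" where
  "entr_kernel P A s =
     (case s of
        None \<Rightarrow> return (cemetery_space A) None
      | Some x \<Rightarrow> distr (chain_law P x) (cemetery_space A) (entr_chain A 1))"

definition exit_states :: "('a::topological_space \<Rightarrow> 'a measure) \<Rightarrow> 'a set \<Rightarrow> 'a set" where
  "exit_states P A = {x \<in> - A. emeasure (chain_law P x) {\<omega>. \<omega> 1 \<in> A} > 0}"

text \<open>\<open>P\<^sub>x(Y\<^sub>1 \<in> dz | Y\<^sub>1 \<in> A)\<close>, used for \<open>x\<close> in \<^const>\<open>exit_states\<close> only.\<close>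

definition cond_step ::
  "('a::topological_space \<Rightarrow> 'a measure) \<Rightarrow> 'a set \<Rightarrow> 'a \<Rightarrow> 'a measure" where
  "cond_step P A x = distr (uniform_measure (chain_law P x) {\<omega>. \<omega> 1 \<in> A}) borel (\<lambda>\<omega>. \<omega> 1)"

text \<open>\<open>exit_kernel P A\<close> is the kernel, on the complement of \<open>A\<close> and the cemetery state, of the chain
  of exit positions from the complement of \<open>A\<close>. The outer integral may run over the whole
  space, because \<open>cond_step P A x\<close> is concentrated on \<open>A\<close>.\<close>

definition exit_kernel ::
  "('a::topological_space \<Rightarrow> 'a measure) \<Rightarrow> 'a set \<Rightarrow> 'a option \<Rightarrow> 'a option measure" where
  "exit_kernel P A s =
     (case s of
        None \<Rightarrow> return (cemetery_space (- A)) None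
      | Some x \<Rightarrow>
          if x \<in> exit_states P A
          then cond_step P A x \<bind> (\<lambda>z. distr (chain_law P z) (cemetery_space (- A)) (exit_chain A 1))
          else return (cemetery_space (- A)) None)"

definition recurrent_states :: "('a::topological_space \<Rightarrow> 'a measure) \<Rightarrow> 'a set \<Rightarrow> 'a set" where
  "recurrent_states P A =
     {x. emeasure (chain_law P x) {\<omega>. (\<exists>\<^sub>\<infinity>k. \<omega> k \<in> A) \<and> (\<exists>\<^sub>\<infinity>k. \<omega> k \<in> - A)} = 1}"

definition proper_entr ::
  "('a::topological_space \<Rightarrow> 'a measure) \<Rightarrow> 'a set \<Rightarrow> 'a measure \<Rightarrow> bool" where
  "proper_entr P A \<nu> \<longleftrightarrow> A - recurrent_states P A \<in> null_sets \<nu>"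

definition proper_exit ::
  "('a::topological_space \<Rightarrow> 'a measure) \<Rightarrow> 'a set \<Rightarrow> 'a measure \<Rightarrow> bool" where
  "proper_exit P A \<nu> \<longleftrightarrow> - A - (exit_states P A \<inter> recurrent_states P A) \<in> null_sets \<nu>"

definition invariant_entr ::
  "('a::topological_space \<Rightarrow> 'a measure) \<Rightarrow> 'a set \<Rightarrow> 'a measure \<Rightarrow> bool" where
  "invariant_entr P A \<nu> \<longleftrightarrow>
     invariant_measure (\<lambda>x B. emeasure (entr_kernel P A (Some x)) (Some ` B)) \<nu>"

definition invariant_exit ::
  "('a::topological_space \<Rightarrow> 'a measure) \<Rightarrow> 'a set \<Rightarrow> 'a measure \<Rightarrow> bool" where
  "invariant_exit P A \<nu> \<longleftrightarrow>
     invariant_measure (\<lambda>x B. emeasure (exit_kernel P A (Some x)) (Some ` B)) \<nu>"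

definition mu_entr ::
  "('a::topological_space \<Rightarrow> 'a measure) \<Rightarrow> 'a measure \<Rightarrow> 'a set \<Rightarrow> 'a measure" where
  "mu_entr P \<mu> A =
     measure_of A (sets (restrict_space borel A))
       (\<lambda>B. \<integral>\<^sup>+x\<in>- A. emeasure (chain_law P x) {\<omega>. \<omega> 1 \<in> B} \<partial>\<mu>)"

definition mu_exit ::
  "('a::topological_space \<Rightarrow> 'a measure) \<Rightarrow> 'a measure \<Rightarrow> 'a set \<Rightarrow> 'a measure" where
  "mu_exit P \<mu> A =
     density (restrict_space \<mu> (- A)) (\<lambda>x. emeasure (chain_law P x) {\<omega>. \<omega> 1 \<in> A})"

end

(*
  Under the path law with the infinite initial measure \<mu>, which is shift invariant, the first
  steps of Y read backwards are distributed like the first steps of the dual chain. Consider the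
  paths of Y which enter A at time 1, do not enter A at the times 2, ..., n+1, and whose step from
  time n+1 to time n+2 lies in a given set G of pairs. Read backwards, they are the paths of the
  dual chain whose initial step, reversed, lies in G and whose first exit from A after time 1
  happens at time n+2. Since the dual chain almost surely leaves A, summing over n removes the
  condition on the exit time, and the total mass is the \<mu>-mass of the paths of Y with initial step
  in G. Suitable choices of G give the invariance of the entrance and exit measures and the
  formula for \<mu>.

  The dual kernel is a disintegration of \<mu>(dx) P(x,dy) along y. Points x are coded by sequences
  of natural numbers; the Radon-Nikodym densities of the finite prefixes of the code are, for
  almost every y, consistent prefix probabilities of a law on sequences, which is pushed forward
  to the state space by decoding.
*)
theory Submission
  imports Defs
begin

section \<open>The path law of a Markov chain\<close>

text \<open>Since \<mu> may be infinite, masses cannot be subtracted freely. Reversal avoids this: a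
  crossing that follows after any number of steps becomes a first exit of the dual chain, and first
  exits split a path event disjointly, so countable additivity suffices. As for \<open>G\<close>,
  \<open>UNIV \<times> B\<close> records the state entered and \<open>B \<times> UNIV\<close> the
  state left. For the two invariance statements \<open>G\<close> is cut down to
  \<open>(- A) \<times> A\<close>, which makes the forward events disjoint as well; the occupation
  formula keeps \<open>B \<times> UNIV\<close> uncut, and its overlapping forward events count
  visits. The escape conditions on Y make \<mu>-almost every state recurrent, hence properness;
  those on the dual chain give the almost sure exit. Sigma-finiteness supplies the finite pieces
  that let an intersection-stable generator determine a measure, and the Radon-Nikodym densities.
  Where these densities fail to be consistent, a fixed default law is substituted, so that the dual
  kernel is defined and measurable everywhere.\<close>

lemma (in Ionescu_Tulcea) nn_integral_lim:
  assumes F[measurable]: "F \<in> borel_measurable (PiM {0..<n} M)"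
  shows "(\<integral>\<^sup>+\<omega>. F (restrict \<omega> {0..<n}) \<partial>PF.lim) = (\<integral>\<^sup>+\<omega>. F \<omega> \<partial>C 0 n (\<lambda>_. undefined))"
proof -
  have m: "(\<lambda>\<omega>. restrict \<omega> {0..<n}) \<in> PF.lim \<rightarrow>\<^sub>M PiM {0..<n} M"
    by (simp add: measurable_cong_sets[OF PF.sets_lim refl] measurable_restrict_subset)
  \<comment> \<open>\<open>CI J\<close> projects the law of the first \<open>up_to J\<close>
    coordinates to \<open>J\<close>; for an initial segment nothing is projected away and
    \<open>CI\<close> is \<open>C\<close> itself.\<close>
  have ut: "up_to {0..<n} = n"
  proof (rule antisym)
    show "up_to {0..<n} \<le> n"
      by (simp add: up_to_iff)
    show "n \<le> up_to {0..<n}"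
      using up_to_iff_Ico[of "{0..<n}" "up_to {0..<n}"] by (cases "n = 0") simp_all
  qed
  have x0: "(\<lambda>_. undefined) \<in> space (PiM {0..<0} M)"
    by (simp add: space_PiM)
  have C: "CI {0..<n} = C 0 n (\<lambda>_. undefined)"
    using distr_C[OF order_refl x0, of n] by (simp add: CI_def ut)
  have "(\<integral>\<^sup>+\<omega>. F (restrict \<omega> {0..<n}) \<partial>PF.lim)
      = (\<integral>\<^sup>+\<omega>. F \<omega> \<partial>distr PF.lim (PiM {0..<n} M) (\<lambda>\<omega>. restrict \<omega> {0..<n}))"
    by (rule nn_integral_distr[OF m, symmetric]) simp
  then show ?thesis
    by (simp add: distr_lim C)
qed

lemma (in Ionescu_Tulcea) prob_space_lim: "prob_space PF.lim"
proof (rule prob_spaceI)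
  have x0: "(\<lambda>_. undefined) \<in> space (PiM {0..<0} M)"
    by (simp add: space_PiM)
  show "emeasure PF.lim (space PF.lim) = 1"
    using nn_integral_lim[of "\<lambda>_. 1" 0] prob_space.emeasure_space_1[OF prob_space_C[OF x0, of 0]]
    by (simp del: C.simps)
qed

text \<open>The law of \<open>Suc n\<close> coordinates is the law of \<open>n\<close> coordinates
  bound to one more draw. Both the path law and the law on digit sequences are computed through this
  single step.\<close>

lemma (in Ionescu_Tulcea) nn_integral_lim_Suc:
  assumes F[measurable]: "F \<in> borel_measurable (PiM {0..<Suc n} M)"
  shows "(\<integral>\<^sup>+\<omega>. F (restrict \<omega> {0..<Suc n}) \<partial>PF.lim) =
    (\<integral>\<^sup>+\<omega>. (\<integral>\<^sup>+y. F ((restrict \<omega> {0..<n})(n := y)) \<partial>P n (restrict \<omega> {0..<n})) \<partial>PF.lim)"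
proof -
  let ?u = "\<lambda>_::nat. undefined :: 'a"
  have x0: "?u \<in> space (PiM {0..<0} M)"
    by (simp add: space_PiM)
  have eP: "eP n \<in> PiM {0..<n} M \<rightarrow>\<^sub>M subprob_algebra (PiM {0..<Suc n} M)"
    by (rule measurable_eP)
  have upd: "(\<integral>\<^sup>+x. F x \<partial>eP n \<omega>) = (\<integral>\<^sup>+y. F (fun_upd \<omega> n y) \<partial>P n \<omega>)" if "\<omega> \<in> space (PiM {0..<n} M)" for \<omega>
    by (rule nn_integral_eP[OF that F])
  have sC: "sets (C 0 n ?u) = sets (PiM {0..<n} M)"
    using sets_C[OF x0, of n] by simp
  have m: "(\<lambda>\<omega>. \<integral>\<^sup>+y. F (fun_upd \<omega> n y) \<partial>P n \<omega>) \<in> borel_measurable (PiM {0..<n} M)"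
    by (subst measurable_cong[OF upd[symmetric]], assumption)
       (rule nn_integral_measurable_subprob_algebra2[where N="PiM {0..<Suc n} M"], simp, rule eP)
  have "(\<integral>\<^sup>+\<omega>. F (restrict \<omega> {0..<Suc n}) \<partial>PF.lim) = (\<integral>\<^sup>+\<omega>. F \<omega> \<partial>(C 0 n ?u \<bind> eP n))"
    using nn_integral_lim[OF F] by simp
  also have "\<dots> = (\<integral>\<^sup>+\<omega>. (\<integral>\<^sup>+x. F x \<partial>eP n \<omega>) \<partial>C 0 n ?u)"
    by (rule nn_integral_bind[OF F]) (simp add: measurable_cong_sets[OF sC refl])
  also have "\<dots> = (\<integral>\<^sup>+\<omega>. (\<integral>\<^sup>+y. F (fun_upd \<omega> n y) \<partial>P n \<omega>) \<partial>C 0 n ?u)"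
    by (intro nn_integral_cong upd) (simp add: sets_eq_imp_space_eq[OF sC])
  also have "\<dots> = (\<integral>\<^sup>+\<omega>. (\<integral>\<^sup>+y. F ((restrict \<omega> {0..<n})(n := y)) \<partial>P n (restrict \<omega> {0..<n})) \<partial>PF.lim)"
    by (rule nn_integral_lim[OF m, symmetric])
  finally show ?thesis .
qed

section \<open>Cylinder sets of the path space\<close>

lemma sets_PiM_cylinders:
  fixes M :: "'a measure"
  shows "sets (PiM UNIV (\<lambda>_::nat. M)) = sigma_sets (space (PiM UNIV (\<lambda>_::nat. M)))
    {{\<omega>\<in>space (PiM UNIV (\<lambda>_::nat. M)). \<forall>i<n. \<omega> i \<in> S i} | n S. range S \<subseteq> sets M}" (is "_ = sigma_sets ?X ?G")
proof (rule antisym)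
  have "{f \<in> ?X. f i \<in> A} \<in> ?G" if A: "A \<in> sets M" for i A
  proof -
    have "{f \<in> ?X. f i \<in> A} = {\<omega>\<in>?X. \<forall>j<Suc i. \<omega> j \<in> (if j = i then A else space M)}"
      by (auto simp: space_PiM less_Suc_eq)
    then show ?thesis using A
      by (intro CollectI exI[of _ "Suc i"] exI[of _ "\<lambda>j. if j = i then A else space M"] conjI) auto
  qed
  then show "sets (PiM UNIV (\<lambda>_::nat. M)) \<subseteq> sigma_sets ?X ?G"
    unfolding sets_PiM_single space_PiM[symmetric] by (intro sigma_sets_mono') auto
  have "{\<omega>\<in>?X. \<forall>i<n. \<omega> i \<in> S i} \<in> sets (PiM UNIV (\<lambda>_::nat. M))" if "range S \<subseteq> sets M" for n :: nat and S
  proof -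
    have [measurable]: "S i \<in> sets M" for i using that by auto
    show ?thesis by measurable
  qed
  then show "sigma_sets ?X ?G \<subseteq> sets (PiM UNIV (\<lambda>_::nat. M))"
    by (intro sets.sigma_sets_subset) auto
qed

text \<open>Rectangles over initial segments. Only the first \<open>n\<close> sets matter, but
  \<open>S\<close> is Borel at every index to avoid side conditions; \<open>n = 0\<close> gives the
  whole space.\<close>

definition cylinders :: "(nat \<Rightarrow> 'a::topological_space) set set" where
  "cylinders = {{\<omega>. \<forall>i<n. \<omega> i \<in> S i} | n S. range S \<subseteq> sets borel}"

lemma space_path_space[simp]: "space (path_space :: (nat \<Rightarrow> 'a::topological_space) measure) = UNIV"
  by (simp add: space_PiM)

lemma sets_path_space_cylinders:
  "sets (path_space :: (nat \<Rightarrow> 'a::topological_space) measure) = sigma_sets UNIV cylinders"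
  unfolding sets_PiM_cylinders cylinders_def by simp

lemma cylindersI: "(\<And>i. S i \<in> sets borel) \<Longrightarrow> {\<omega>. \<forall>i<n. \<omega> i \<in> S i} \<in> cylinders"
  unfolding cylinders_def by (rule CollectI, rule exI[of _ n], rule exI[of _ S]) auto

lemma cylindersE:
  assumes "C \<in> cylinders"
  obtains n S where "C = {\<omega>. \<forall>i<n. \<omega> i \<in> S i}" "\<And>i. S i \<in> sets borel"
proof -
  obtain n S where *: "C = {\<omega>. \<forall>i<n. \<omega> i \<in> S i}" "range S \<subseteq> sets borel"
    using assms unfolding cylinders_def by auto
  show ?thesis
    using *(2) by (intro that[OF *(1)]) auto
qed

lemma cylinders_sets: "C \<in> cylinders \<Longrightarrow> C \<in> sets path_space"
  unfolding sets_path_space_cylinders by (rule sigma_sets.Basic)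

lemma Int_stable_cylinders: "Int_stable cylinders"
proof (rule Int_stableI)
  fix a b :: "(nat \<Rightarrow> 'a) set" assume ab: "a \<in> cylinders" "b \<in> cylinders"
  obtain n S where a: "a = {\<omega>. \<forall>i<n. \<omega> i \<in> S i}" "\<And>i. S i \<in> sets borel"
    using ab(1) by (rule cylindersE) (rule that)
  obtain m T where b: "b = {\<omega>. \<forall>i<m. \<omega> i \<in> T i}" "\<And>i. T i \<in> sets borel"
    using ab(2) by (rule cylindersE) (rule that)
  \<comment> \<open>The shorter cylinder is padded with \<open>UNIV\<close> up to the common
    length.\<close>
  have "a \<inter> b = {\<omega>. \<forall>i<max n m. \<omega> i \<in> (if i < n then S i else UNIV) \<inter> (if i < m then T i else UNIV)}"
    unfolding a b by (simp add: set_eq_iff less_max_iff_disj) blast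
  also have "\<dots> \<in> cylinders"
    by (intro cylindersI sets.Int) (auto simp: a(2) b(2))
  finally show "a \<inter> b \<in> cylinders" .
qed

lemma UNIV_cylinders: "UNIV \<in> cylinders"
  using cylindersI[of "\<lambda>_. UNIV" 0] by simp

section \<open>Finite-dimensional laws and the Markov property\<close>

lemma transition_kernelD:
  assumes "transition_kernel P"
  shows "P \<in> borel \<rightarrow>\<^sub>M subprob_algebra borel" "prob_space (P x)" "sets (P x) = sets borel" "space (P x) = UNIV"
proof -
  have P: "P \<in> borel \<rightarrow>\<^sub>M prob_algebra borel"
    using assms by (simp add: transition_kernel_def)
  show "P \<in> borel \<rightarrow>\<^sub>M subprob_algebra borel"
    by (rule measurable_prob_algebraD[OF P])
  have "P x \<in> space (prob_algebra borel)"
    using measurable_space[OF P, of x] by simp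
  then show "prob_space (P x)" and s: "sets (P x) = sets borel"
    by (auto simp: space_prob_algebra)
  show "space (P x) = UNIV"
    using sets_eq_imp_space_eq[OF s] by simp
qed

lemma Ionescu_Tulcea_chain_step:
  assumes "transition_kernel P"
  shows "Ionescu_Tulcea (chain_step P x) (\<lambda>_. borel)"
proof (rule Ionescu_Tulcea.intro)
  note [measurable] = transition_kernelD(1)[OF assms]
  show "chain_step P x i \<in> PiM {0..<i} (\<lambda>_. borel) \<rightarrow>\<^sub>M subprob_algebra borel" for i
  proof (cases i)
    case 0
    have "return borel x \<in> space (subprob_algebra borel)"
      by (simp add: space_subprob_algebra prob_space_imp_subprob_space prob_space_return)
    then show ?thesis using 0 by (simp add: chain_step_def[abs_def])
  next
    case (Suc m)
    then have "chain_step P x i = (\<lambda>\<omega>. P (\<omega> m))"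
      by (simp add: chain_step_def fun_eq_iff)
    moreover have "(\<lambda>\<omega>. \<omega> m) \<in> PiM {0..<i} (\<lambda>_. borel) \<rightarrow>\<^sub>M borel"
      by (simp add: Suc)
    from measurable_compose[OF this transition_kernelD(1)[OF assms]]
    have "(\<lambda>\<omega>. P (\<omega> m)) \<in> PiM {0..<i} (\<lambda>_. borel) \<rightarrow>\<^sub>M subprob_algebra borel" .
    ultimately show ?thesis by simp
  qed
  show "prob_space (chain_step P x i \<omega>)" for i \<omega>
    by (auto simp: chain_step_def transition_kernelD(2)[OF assms] prob_space_return split: nat.split)
qed

lemma nn_integral_P_measurable:
  assumes "transition_kernel P" and f: "f \<in> borel_measurable borel"
  shows "(\<lambda>x. \<integral>\<^sup>+y. f y \<partial>P x) \<in> borel_measurable borel"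
  by (rule measurable_compose[OF transition_kernelD(1)[OF assms(1)] nn_integral_measurable_subprob_algebra[OF f]])

text \<open>For \<open>Ss = [S0, ..., Sm]\<close> this is the expectation, for the chain started at
  \<open>x\<close>, of the indicator that the times 0 to m lie in S0, ..., Sm, times
  \<open>f\<close> at time m + 1. With lists, time reversal becomes \<open>rev\<close>.\<close>

primrec path_int ::
  "('a::topological_space \<Rightarrow> 'a measure) \<Rightarrow> 'a set list \<Rightarrow> ('a \<Rightarrow> ennreal) \<Rightarrow> 'a \<Rightarrow> ennreal" where
  "path_int P [] f = f"
| "path_int P (S # Ss) f = (\<lambda>x. indicator S x * (\<integral>\<^sup>+y. path_int P Ss f y \<partial>P x))"

lemma path_int_append: "path_int P (Ss @ Ts) f = path_int P Ss (path_int P Ts f)"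
  by (induction Ss) auto

lemma path_int_measurable:
  assumes P: "transition_kernel P" and f: "f \<in> borel_measurable borel" and S: "set Ss \<subseteq> sets borel"
  shows "path_int P Ss f \<in> borel_measurable borel"
  using S
proof (induction Ss)
  case (Cons S Ss)
  then have [measurable]: "S \<in> sets borel" "path_int P Ss f \<in> borel_measurable borel" by auto
  show ?case
    using nn_integral_P_measurable[OF P, of "path_int P Ss f"] by simp
qed (simp add: f)

context
  fixes P :: "'a::topological_space \<Rightarrow> 'a measure"
  assumes tk: "transition_kernel P"
begin

lemma sets_chain_law[measurable_cong]: "sets (chain_law P x) = sets path_space"
proof -
  interpret Ionescu_Tulcea "chain_step P x" "\<lambda>_. borel"
    by (rule Ionescu_Tulcea_chain_step[OF tk])
  show ?thesis by (simp add: chain_law_def)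
qed

lemma space_chain_law[simp]: "space (chain_law P x) = UNIV"
  using sets_eq_imp_space_eq[OF sets_chain_law] by simp

text \<open>The kernel at index \<open>Suc n\<close> looks only at coordinate \<open>n\<close>, so
  integrating out the last coordinate replaces \<open>f\<close> by its \<open>P\<close>-average at
  \<open>\<omega> n\<close>.\<close>

lemma nn_integral_chain_law_Suc:
  assumes f[measurable]: "f \<in> borel_measurable borel" and "\<And>i. S i \<in> sets borel"
  shows "(\<integral>\<^sup>+\<omega>. (\<Prod>i<Suc n. indicator (S i) (\<omega> i)) * f (\<omega> (Suc n)) \<partial>chain_law P x) =
    (\<integral>\<^sup>+\<omega>. (\<Prod>i<n. indicator (S i) (\<omega> i)) * (indicator (S n) (\<omega> n) * (\<integral>\<^sup>+y. f y \<partial>P (\<omega> n))) \<partial>chain_law P x)"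
proof -
  interpret Ionescu_Tulcea "chain_step P x" "\<lambda>_. borel"
    by (rule Ionescu_Tulcea_chain_step[OF tk])
  let ?F = "\<lambda>\<omega>::nat\<Rightarrow>'a. (\<Prod>i<Suc n. indicator (S i) (\<omega> i)) * f (\<omega> (Suc n)) :: ennreal"
  have [measurable]: "S i \<in> sets borel" for i by fact
  have F: "?F \<in> borel_measurable (PiM {0..<Suc (Suc n)} (\<lambda>_. borel))"
    by measurable
  have "(\<integral>\<^sup>+\<omega>. ?F \<omega> \<partial>chain_law P x) = (\<integral>\<^sup>+\<omega>. ?F (restrict \<omega> {0..<Suc (Suc n)}) \<partial>PF.lim)"
    unfolding chain_law_def by (intro nn_integral_cong) simp
  also have "\<dots> = (\<integral>\<^sup>+\<omega>. (\<integral>\<^sup>+y. ?F ((restrict \<omega> {0..<Suc n})(Suc n := y))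
      \<partial>chain_step P x (Suc n) (restrict \<omega> {0..<Suc n})) \<partial>PF.lim)"
    by (rule nn_integral_lim_Suc[OF F])
  also have "\<dots> = (\<integral>\<^sup>+\<omega>. (\<integral>\<^sup>+y. (\<Prod>i<Suc n. indicator (S i) (\<omega> i)) * f y \<partial>P (\<omega> n)) \<partial>chain_law P x)"
    unfolding chain_law_def by (intro nn_integral_cong) (simp add: chain_step_def)
  also have "\<dots> = (\<integral>\<^sup>+\<omega>. (\<Prod>i<Suc n. indicator (S i) (\<omega> i)) * (\<integral>\<^sup>+y. f y \<partial>P (\<omega> n)) \<partial>chain_law P x)"
    by (intro nn_integral_cong nn_integral_cmult) (simp add: measurable_cong_sets[OF transition_kernelD(3)[OF tk] refl])
  finally show ?thesis by (simp add: mult.assoc)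
qed

lemma nn_integral_chain_law_0:
  assumes f[measurable]: "f \<in> borel_measurable borel"
  shows "(\<integral>\<^sup>+\<omega>. f (\<omega> 0) \<partial>chain_law P x) = f x"
proof -
  interpret Ionescu_Tulcea "chain_step P x" "\<lambda>_. borel"
    by (rule Ionescu_Tulcea_chain_step[OF tk])
  let ?F = "\<lambda>\<omega>::nat\<Rightarrow>'a. f (\<omega> 0)"
  have F: "?F \<in> borel_measurable (PiM {0..<Suc 0} (\<lambda>_. borel))"
    by measurable
  have "(\<integral>\<^sup>+\<omega>. ?F \<omega> \<partial>chain_law P x) = (\<integral>\<^sup>+\<omega>. ?F (restrict \<omega> {0..<Suc 0}) \<partial>PF.lim)"
    unfolding chain_law_def by (intro nn_integral_cong) simp
  also have "\<dots> = (\<integral>\<^sup>+\<omega>. (\<integral>\<^sup>+y. f y \<partial>return borel x) \<partial>PF.lim)"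
    by (subst nn_integral_lim_Suc[OF F]) (simp add: chain_step_def)
  also have "\<dots> = f x"
    using prob_space.emeasure_space_1[OF prob_space_lim] by (simp add: nn_integral_return)
  finally show ?thesis .
qed

lemma prob_space_chain_law: "prob_space (chain_law P x)"
proof
  show "emeasure (chain_law P x) (space (chain_law P x)) = 1"
    using nn_integral_chain_law_0[of "\<lambda>_. 1" x] by simp
qed

text \<open>Induction peels off the last coordinate, which turns \<open>f\<close> into the function
  \<open>indicator (S n) x * (\<integral>\<^sup>+y. f y \<partial>P x)\<close>; hence
  \<open>f\<close> must be arbitrary in the induction.\<close>

lemma nn_integral_chain_law:
  assumes "f \<in> borel_measurable borel" and "\<And>i. S i \<in> sets borel"
  shows "(\<integral>\<^sup>+\<omega>. (\<Prod>i<n. indicator (S i) (\<omega> i)) * f (\<omega> n) \<partial>chain_law P x) = path_int P (map S [0..<n]) f x"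
  using assms(1)
proof (induction n arbitrary: f)
  case 0
  then show ?case by (simp add: nn_integral_chain_law_0)
next
  case (Suc n)
  note [measurable] = assms(2) Suc.prems nn_integral_P_measurable[OF tk Suc.prems]
  have "(\<integral>\<^sup>+\<omega>. (\<Prod>i<Suc n. indicator (S i) (\<omega> i)) * f (\<omega> (Suc n)) \<partial>chain_law P x) =
      path_int P (map S [0..<n]) (\<lambda>x. indicator (S n) x * (\<integral>\<^sup>+y. f y \<partial>P x)) x"
    using Suc.IH[of "\<lambda>x. indicator (S n) x * (\<integral>\<^sup>+y. f y \<partial>P x)"]
    by (simp only: nn_integral_chain_law_Suc[OF Suc.prems assms(2)]) (simp add: assms(2))
  then show ?case by (simp add: path_int_append)
qed

lemma emeasure_chain_law_cylinder:
  assumes "\<And>i. S i \<in> sets borel"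
  shows "emeasure (chain_law P x) {\<omega>. \<forall>i<n. \<omega> i \<in> S i} = path_int P (map S [0..<n]) (\<lambda>_. 1) x"
proof -
  note [measurable] = assms
  have "{\<omega>. \<forall>i<n. \<omega> i \<in> S i} \<in> sets path_space"
    by (intro cylinders_sets cylindersI assms)
  then have "emeasure (chain_law P x) {\<omega>. \<forall>i<n. \<omega> i \<in> S i} =
      (\<integral>\<^sup>+\<omega>. (\<Prod>i<n. indicator (S i) (\<omega> i)) * 1 \<partial>chain_law P x)"
    by (subst nn_integral_indicator[symmetric])
       (auto simp: sets_chain_law simp del: nn_integral_indicator intro!: nn_integral_cong simp: indicator_def)
  also have "\<dots> = path_int P (map S [0..<n]) (\<lambda>_. 1) x"
    by (rule nn_integral_chain_law) (simp_all add: assms)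
  finally show ?thesis .
qed

text \<open>Measurability in the starting point need only be checked on the generator, where the
  probability is an iterated integral \<open>path_int\<close>.\<close>

lemma chain_law_kernel: "chain_law P \<in> borel \<rightarrow>\<^sub>M prob_algebra path_space"
proof (rule measurable_prob_algebra_generated[OF sets_path_space_cylinders Int_stable_cylinders])
  fix A :: "(nat \<Rightarrow> 'a) set" assume "A \<in> cylinders"
  then obtain n S where A: "A = {\<omega>. \<forall>i<n. \<omega> i \<in> S i}" and S: "\<And>i. S i \<in> sets borel"
    by (rule cylindersE) (rule that)
  have "emeasure (chain_law P x) A = path_int P (map S [0..<n]) (\<lambda>_. 1) x" for x
    unfolding A by (rule emeasure_chain_law_cylinder) (rule S)
  then show "(\<lambda>a. emeasure (chain_law P a) A) \<in> borel_measurable borel"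
    using S by (simp add: path_int_measurable[OF tk] image_subset_iff)
qed (auto simp: prob_space_chain_law sets_chain_law)

lemmas chain_law_subprob = measurable_prob_algebraD[OF chain_law_kernel]

lemma emeasure_chain_law_measurable:
  "E \<in> sets path_space \<Longrightarrow> (\<lambda>x. emeasure (chain_law P x) E) \<in> borel_measurable borel"
  by (rule measurable_compose[OF chain_law_subprob measurable_emeasure_subprob_algebra])

lemma measurable_case_nat_path: "case_nat x \<in> path_space \<rightarrow>\<^sub>M path_space"
proof (rule measurable_PiM_single')
  show "(\<lambda>\<omega>. case_nat x \<omega> i) \<in> borel_measurable path_space" for i
    by (cases i) auto
qed auto

text \<open>The path law is built by appending coordinates, while the Markov property at time 1
  splits off the front. The two agree on cylinders because \<open>path_int\<close> recurses on its
  first set.\<close>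

lemma chain_law_one_step:
  assumes E: "E \<in> sets path_space"
  shows "emeasure (chain_law P x) E = (\<integral>\<^sup>+y. emeasure (chain_law P y) {\<omega>. case_nat x \<omega> \<in> E} \<partial>P x)"
proof -
  let ?d = "\<lambda>y. distr (chain_law P y) path_space (case_nat x)"
  have m[measurable]: "case_nat x \<in> path_space \<rightarrow>\<^sub>M path_space"
    by (rule measurable_case_nat_path)
  have m': "case_nat x \<in> chain_law P y \<rightarrow>\<^sub>M path_space" for y
    by (simp add: measurable_cong_sets[OF sets_chain_law refl])
  have dk: "?d \<in> borel \<rightarrow>\<^sub>M subprob_algebra path_space"
    by (rule measurable_compose[OF chain_law_subprob measurable_distr[OF m]])
  then have dk': "?d \<in> P x \<rightarrow>\<^sub>M subprob_algebra path_space"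
    by (simp add: measurable_cong_sets[OF transition_kernelD(3)[OF tk] refl])
  have ne: "space (P x) \<noteq> {}" by (simp add: transition_kernelD(4)[OF tk])
  have em: "emeasure (P x \<bind> ?d) E = (\<integral>\<^sup>+y. emeasure (chain_law P y) {\<omega>. case_nat x \<omega> \<in> E} \<partial>P x)"
    if E: "E \<in> sets path_space" for E
    by (subst emeasure_bind[OF ne dk' E]) (auto simp: emeasure_distr[OF m' E] vimage_def intro!: nn_integral_cong)
  have "chain_law P x = P x \<bind> ?d"
  proof (rule measure_eqI_generator_eq[OF Int_stable_cylinders])
    fix X :: "(nat \<Rightarrow> 'a) set" assume X: "X \<in> cylinders"
    then obtain n S where XS: "X = {\<omega>. \<forall>i<n. \<omega> i \<in> S i}" and S: "\<And>i. S i \<in> sets borel"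
      by (rule cylindersE) (rule that)
    show "emeasure (chain_law P x) X = emeasure (P x \<bind> ?d) X"
    proof (cases n)
      case 0
      then have "X = UNIV" by (simp add: XS)
      then show ?thesis
        unfolding em[OF cylinders_sets[OF X]]
        using prob_space.emeasure_space_1[OF prob_space_chain_law]
          prob_space.emeasure_space_1[OF transition_kernelD(2)[OF tk, of x]] by simp
    next
      case (Suc m)
      \<comment> \<open>Prefixing \<open>x\<close> tests it against \<open>S 0\<close> and moves
        every other constraint one step earlier; this needs a first constraint, so
        \<open>n = 0\<close> is a separate case.\<close>
      have "{\<omega>. case_nat x \<omega> \<in> X} = (if x \<in> S 0 then {\<omega>. \<forall>i<m. \<omega> i \<in> S (Suc i)} else {})"
        unfolding XS Suc by (auto simp: All_less_Suc2)
      moreover have "emeasure (chain_law P y) {\<omega>. \<forall>i<m. \<omega> i \<in> S (Suc i)} =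
          path_int P (map (\<lambda>i. S (Suc i)) [0..<m]) (\<lambda>_. 1) y" for y
        by (rule emeasure_chain_law_cylinder) (rule S)
      ultimately have r: "emeasure (P x \<bind> ?d) X = path_int P (S 0 # map (\<lambda>i. S (Suc i)) [0..<m]) (\<lambda>_. 1) x"
        unfolding em[OF cylinders_sets[OF X]] by (cases "x \<in> S 0") simp_all
      have "emeasure (chain_law P x) X = path_int P (map S [0..<Suc m]) (\<lambda>_. 1) x"
        unfolding XS Suc by (rule emeasure_chain_law_cylinder) (rule S)
      also have "map S [0..<Suc m] = S 0 # map (\<lambda>i. S (Suc i)) [0..<m]"
        by (simp add: map_upt_Suc del: upt_Suc)
      finally show ?thesis
        by (simp only: r)
    qed
  next
    show "range (\<lambda>_. UNIV) \<subseteq> cylinders" using UNIV_cylinders by auto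
    show "emeasure (chain_law P x) UNIV \<noteq> \<infinity>"
      using prob_space.emeasure_space_1[OF prob_space_chain_law[of x]] by simp
    show "sets (chain_law P x) = sigma_sets UNIV cylinders"
      by (simp add: sets_chain_law sets_path_space_cylinders)
    show "sets (P x \<bind> ?d) = sigma_sets UNIV cylinders"
      by (subst sets_bind[OF _ ne, of _ path_space]) (auto simp: sets_path_space_cylinders)
  qed auto
  then show ?thesis using em[OF E] by simp
qed

lemma emeasure_chain_law_1:
  assumes B: "B \<in> sets borel"
  shows "emeasure (chain_law P x) {\<omega>. \<omega> 1 \<in> B} = emeasure (P x) B"
proof -
  have [measurable]: "B \<in> sets borel" by fact
  have E: "{\<omega>. \<omega> 1 \<in> B} \<in> sets path_space"
    using measurable_sets[OF measurable_component_singleton[of "1::nat" UNIV "\<lambda>_. borel"] B] by (simp add: vimage_def)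
  have E0: "{\<omega>. \<omega> 0 \<in> B} \<in> sets path_space"
    using measurable_sets[OF measurable_component_singleton[of "0::nat" UNIV "\<lambda>_. borel"] B] by (simp add: vimage_def)
  have "emeasure (chain_law P y) {\<omega>. \<omega> 0 \<in> B} = (\<integral>\<^sup>+\<omega>. indicator B (\<omega> 0) \<partial>chain_law P y)" for y
    using E0 by (subst nn_integral_indicator[symmetric])
      (auto simp: sets_chain_law simp del: nn_integral_indicator intro!: nn_integral_cong split: split_indicator)
  then have "emeasure (chain_law P y) {\<omega>. \<omega> 0 \<in> B} = indicator B y" for y
    by (simp add: nn_integral_chain_law_0)
  then show ?thesis
    using chain_law_one_step[OF E] by (simp add: transition_kernelD(3)[OF tk])
qed

end

section \<open>Crossings and the entrance measure\<close>

text \<open>Indexed by the time before the step, so that no truncated \<open>k - 1\<close> occurs;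
  the entrance itself happens at time \<open>Suc i\<close>.\<close>

definition crossing :: "'a set \<Rightarrow> (nat \<Rightarrow> 'a) \<Rightarrow> nat \<Rightarrow> bool" where
  "crossing A \<omega> i \<longleftrightarrow> \<omega> i \<notin> A \<and> \<omega> (Suc i) \<in> A"

lemma entr_time_1: "entr_time A 1 \<omega> = Inf {enat (Suc i) | i. crossing A \<omega> i}"
proof -
  have "{enat k | k. enat k > 0 \<and> \<omega> (k - 1) \<notin> A \<and> \<omega> k \<in> A} = {enat (Suc i) | i. crossing A \<omega> i}"
    unfolding crossing_def
  proof (intro set_eqI iffI; clarify)
    fix k assume "(0::enat) < enat k" "\<omega> (k - 1) \<notin> A" "\<omega> k \<in> A"
    then show "\<exists>i. enat k = enat (Suc i) \<and> \<omega> i \<notin> A \<and> \<omega> (Suc i) \<in> A"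
      by (cases k) (auto simp: zero_enat_def)
  next
    fix i assume "\<omega> i \<notin> A" "\<omega> (Suc i) \<in> A"
    then show "\<exists>k. enat (Suc i) = enat k \<and> 0 < enat k \<and> \<omega> (k - 1) \<notin> A \<and> \<omega> k \<in> A"
      by (intro exI[of _ "Suc i"]) (auto simp: zero_enat_def)
  qed
  then show ?thesis by simp
qed

lemma less_entr_time_1: "enat k < entr_time A 1 \<omega> \<longleftrightarrow> (\<forall>i<k. \<not> crossing A \<omega> i)"
proof -
  have "enat k < entr_time A 1 \<omega> \<longleftrightarrow> enat (Suc k) \<le> entr_time A 1 \<omega>"
    by (simp add: Suc_ile_eq)
  also have "\<dots> \<longleftrightarrow> (\<forall>i. crossing A \<omega> i \<longrightarrow> k \<le> i)"
    unfolding entr_time_1 le_Inf_iff by auto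
  also have "\<dots> \<longleftrightarrow> (\<forall>i<k. \<not> crossing A \<omega> i)"
    using not_le by blast
  finally show ?thesis .
qed

lemma entr_time_1_eq_Suc:
  "entr_time A 1 \<omega> = enat (Suc n) \<longleftrightarrow> crossing A \<omega> n \<and> (\<forall>i<n. \<not> crossing A \<omega> i)"
proof -
  have "entr_time A 1 \<omega> = enat (Suc n) \<longleftrightarrow>
      enat n < entr_time A 1 \<omega> \<and> \<not> enat (Suc n) < entr_time A 1 \<omega>"
    by (cases "entr_time A 1 \<omega>") auto
  then show ?thesis
    unfolding less_entr_time_1 by (auto simp: less_Suc_eq)
qed

lemma entr_time_1_eq_infinity: "entr_time A 1 \<omega> = \<infinity> \<longleftrightarrow> (\<forall>i. \<not> crossing A \<omega> i)"
proof -
  have "entr_time A 1 \<omega> = \<infinity> \<longleftrightarrow> (\<forall>k. enat k < entr_time A 1 \<omega>)"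
    by (cases "entr_time A 1 \<omega>") auto
  then show ?thesis
    unfolding less_entr_time_1 by auto
qed

lemma entr_time_1_cases:
  obtains n where "entr_time A 1 \<omega> = enat (Suc n)" | "entr_time A 1 \<omega> = \<infinity>"
proof (cases "entr_time A 1 \<omega>")
  case (enat k)
  have "enat 0 < entr_time A 1 \<omega>" unfolding less_entr_time_1 by simp
  then show ?thesis using enat that(1) by (cases k) auto
qed (rule that(2))

text \<open>At most one \<open>n\<close> can be the first crossing, so the event becomes a countable
  union of finite-horizon events plus the cemetery case. Measurability is read off from this form,
  and it is the form to which reversal applies.\<close>

lemma entr_chain_in_iff:
  "entr_chain A 1 \<omega> \<in> C \<longleftrightarrow>
    (\<exists>n. crossing A \<omega> n \<and> (\<forall>i<n. \<not> crossing A \<omega> i) \<and> Some (\<omega> (Suc n)) \<in> C) \<or>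
    (\<forall>i. \<not> crossing A \<omega> i) \<and> None \<in> C"
proof (cases rule: entr_time_1_cases[of A \<omega>])
  case (1 n)
  note n = 1[unfolded entr_time_1_eq_Suc]
  have "m = n" if "crossing A \<omega> m" "\<forall>i<m. \<not> crossing A \<omega> i" for m
    using n that by (metis linorder_neqE_nat)
  then show ?thesis using 1 n unfolding entr_chain_def by auto
next
  case 2
  then show ?thesis unfolding entr_chain_def using entr_time_1_eq_infinity[of A \<omega>] by auto
qed

lemma exit_chain_in_iff:
  "exit_chain A 1 \<omega> \<in> C \<longleftrightarrow>
    (\<exists>n. crossing A \<omega> n \<and> (\<forall>i<n. \<not> crossing A \<omega> i) \<and> Some (\<omega> n) \<in> C) \<or>
    (\<forall>i. \<not> crossing A \<omega> i) \<and> None \<in> C"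
proof (cases rule: entr_time_1_cases[of A \<omega>])
  case (1 n)
  note n = 1[unfolded entr_time_1_eq_Suc]
  have "m = n" if "crossing A \<omega> m" "\<forall>i<m. \<not> crossing A \<omega> i" for m
    using n that by (metis linorder_neqE_nat)
  then show ?thesis using 1 n unfolding exit_chain_def by auto
next
  case 2
  then show ?thesis unfolding exit_chain_def using entr_time_1_eq_infinity[of A \<omega>] by auto
qed

section \<open>Measurability of the entrance and exit chains\<close>

lemma sigma_algebra_cemetery:
  assumes "S \<in> sets borel"
  shows "sigma_algebra (insert None (Some ` S)) {B. B \<subseteq> insert None (Some ` S) \<and> Some -` B \<in> sets borel}"
  unfolding sigma_algebra_iff2
proof (intro conjI ballI allI impI)
  fix s assume s: "s \<in> {B. B \<subseteq> insert None (Some ` S) \<and> Some -` B \<in> sets borel}"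
  \<comment> \<open>Complements stay in the family because \<open>S\<close> is Borel. The generators
    thus already form a sigma-algebra, and the measurable sets of \<open>cemetery_space\<close> are
    known explicitly.\<close>
  then have "Some -` (insert None (Some ` S) - s) = S - Some -` s"
    by auto
  then show "insert None (Some ` S) - s \<in> {B. B \<subseteq> insert None (Some ` S) \<and> Some -` B \<in> sets borel}"
    using s assms by auto
qed (auto simp: vimage_Union vimage_UN)

lemma
  assumes "S \<in> sets borel"
  shows sets_cemetery_space: "sets (cemetery_space S) = {B. B \<subseteq> insert None (Some ` S) \<and> Some -` B \<in> sets borel}"
    and space_cemetery_space: "space (cemetery_space S) = insert None (Some ` S)"
proof -
  interpret sigma_algebra "insert None (Some ` S)" "{B. B \<subseteq> insert None (Some ` S) \<and> Some -` B \<in> sets borel}"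
    by (rule sigma_algebra_cemetery[OF assms])
  show "sets (cemetery_space S) = {B. B \<subseteq> insert None (Some ` S) \<and> Some -` B \<in> sets borel}"
    unfolding cemetery_space_def by (rule sets_measure_of_eq)
  show "space (cemetery_space S) = insert None (Some ` S)"
    unfolding cemetery_space_def by (rule space_measure_of_eq)
qed

lemma sets_path_spaceI:
  "Measurable.pred path_space P \<Longrightarrow> {\<omega> :: nat \<Rightarrow> 'a::topological_space. P \<omega>} \<in> sets path_space"
  by (simp add: pred_def)

lemma measurable_crossing[measurable]:
  assumes [measurable]: "A \<in> sets borel"
  shows "Measurable.pred path_space (\<lambda>\<omega>. crossing A \<omega> i)"
  unfolding crossing_def by measurable

lemma measurable_entr_chain:
  assumes A[measurable]: "A \<in> sets borel"
  shows "entr_chain A 1 \<in> path_space \<rightarrow>\<^sub>M cemetery_space A"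
proof (rule measurableI)
  fix \<omega> :: "nat \<Rightarrow> 'a"
  show "entr_chain A 1 \<omega> \<in> space (cemetery_space A)"
  proof (cases rule: entr_time_1_cases[of A \<omega>])
    case (1 n)
    then have "\<omega> (Suc n) \<in> A"
      unfolding entr_time_1_eq_Suc crossing_def by simp
    then show ?thesis using 1 by (simp add: space_cemetery_space[OF A] entr_chain_def)
  qed (simp add: space_cemetery_space[OF A] entr_chain_def)
next
  fix C assume "C \<in> sets (cemetery_space A)"
  then have [measurable]: "Some -` C \<in> sets borel" by (simp add: sets_cemetery_space[OF A])
  have "{\<omega>. (\<exists>n. crossing A \<omega> n \<and> (\<forall>i<n. \<not> crossing A \<omega> i) \<and> \<omega> (Suc n) \<in> Some -` C) \<or>
    (\<forall>i. \<not> crossing A \<omega> i) \<and> None \<in> C} \<in> sets path_space"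
    by (rule sets_path_spaceI) measurable
  then show "entr_chain A 1 -` C \<inter> space path_space \<in> sets path_space"
    unfolding vimage_def entr_chain_in_iff by simp
qed

lemma measurable_exit_chain:
  assumes A[measurable]: "A \<in> sets borel"
  shows "exit_chain A 1 \<in> path_space \<rightarrow>\<^sub>M cemetery_space (- A)"
proof (rule measurableI)
  have A': "- A \<in> sets borel" by measurable
  fix \<omega> :: "nat \<Rightarrow> 'a"
  show "exit_chain A 1 \<omega> \<in> space (cemetery_space (- A))"
  proof (cases rule: entr_time_1_cases[of A \<omega>])
    case (1 n)
    then have "\<omega> n \<in> - A"
      unfolding entr_time_1_eq_Suc crossing_def by simp
    then show ?thesis using 1 by (simp add: space_cemetery_space[OF A'] exit_chain_def)
  qed (simp add: space_cemetery_space[OF A'] exit_chain_def)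
next
  have A': "- A \<in> sets borel" by measurable
  fix C assume "C \<in> sets (cemetery_space (- A))"
  then have [measurable]: "Some -` C \<in> sets borel" by (simp add: sets_cemetery_space[OF A'])
  have "{\<omega>. (\<exists>n. crossing A \<omega> n \<and> (\<forall>i<n. \<not> crossing A \<omega> i) \<and> \<omega> n \<in> Some -` C) \<or>
    (\<forall>i. \<not> crossing A \<omega> i) \<and> None \<in> C} \<in> sets path_space"
    by (rule sets_path_spaceI) measurable
  then show "exit_chain A 1 -` C \<inter> space path_space \<in> sets path_space"
    unfolding vimage_def exit_chain_in_iff by simp
qed

section \<open>Path laws with a possibly infinite initial measure\<close>

lemma sets_chain_law_from[measurable_cong, simp]:
  "sets (chain_law_from P \<nu>) = sets (path_space :: (nat \<Rightarrow> 'a::topological_space) measure)"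
  unfolding chain_law_from_def by (rule sets.sets_measure_of_eq)

lemma space_chain_law_from[simp]: "space (chain_law_from P \<nu>) = UNIV"
  using sets_eq_imp_space_eq[OF sets_chain_law_from] by simp

lemma borel_measurable_restrict:
  assumes "sets \<nu> = sets (restrict_space borel A)" and "f \<in> borel_measurable borel"
  shows "f \<in> borel_measurable \<nu>"
  using measurable_restrict_space1[OF assms(2)] by (simp add: measurable_cong_sets[OF assms(1) refl])

text \<open>\<open>measure_of\<close> returns the given set function only once countable additivity
  is known; here it follows by exchanging sum and integral. The set \<open>A\<close> is the subspace
  on which \<open>\<nu>\<close> lives.\<close>

lemma emeasure_chain_law_from:
  assumes tk: "transition_kernel P" and \<nu>: "sets \<nu> = sets (restrict_space borel A)"
    and E: "E \<in> sets path_space"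
  shows "emeasure (chain_law_from P \<nu>) E = (\<integral>\<^sup>+x. emeasure (chain_law P x) E \<partial>\<nu>)"
  unfolding chain_law_from_def
proof (rule emeasure_measure_of_sigma[OF _ _ _ E])
  show "sigma_algebra (space path_space) (sets (path_space :: (nat \<Rightarrow> 'a) measure))"
    by (rule sets.sigma_algebra_axioms)
  show "positive (sets path_space) (\<lambda>E. \<integral>\<^sup>+x. emeasure (chain_law P x) E \<partial>\<nu>)"
    by (simp add: positive_def)
  show "countably_additive (sets path_space) (\<lambda>E. \<integral>\<^sup>+x. emeasure (chain_law P x) E \<partial>\<nu>)"
  proof (rule countably_additiveI)
    fix F :: "nat \<Rightarrow> (nat \<Rightarrow> 'a) set" assume F: "range F \<subseteq> sets path_space" "disjoint_family F"
    have "(\<Sum>i. \<integral>\<^sup>+x. emeasure (chain_law P x) (F i) \<partial>\<nu>) = (\<integral>\<^sup>+x. (\<Sum>i. emeasure (chain_law P x) (F i)) \<partial>\<nu>)"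
      using F(1) by (intro nn_integral_suminf[symmetric] borel_measurable_restrict[OF \<nu>]
        emeasure_chain_law_measurable[OF tk]) auto
    also have "\<dots> = (\<integral>\<^sup>+x. emeasure (chain_law P x) (\<Union>i. F i) \<partial>\<nu>)"
      using F by (intro nn_integral_cong suminf_emeasure) (auto simp: sets_chain_law[OF tk])
    finally show "(\<Sum>i. \<integral>\<^sup>+x. emeasure (chain_law P x) (F i) \<partial>\<nu>) = (\<integral>\<^sup>+x. emeasure (chain_law P x) (\<Union>i. F i) \<partial>\<nu>)" .
  qed
qed

lemma emeasure_chain_law_from_borel:
  assumes "transition_kernel P" "sets \<mu> = sets borel" "E \<in> sets path_space"
  shows "emeasure (chain_law_from P \<mu>) E = (\<integral>\<^sup>+x. emeasure (chain_law P x) E \<partial>\<mu>)"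
  using assms(2) by (intro emeasure_chain_law_from[where A=UNIV] assms) (simp add: sets_restrict_space)

text \<open>For a Borel set \<open>D\<close> the start lies in \<open>D\<close> with probability 0
  or 1, according to \<open>x\<close>. The argument uses such sets instead of the event that the
  start equals \<open>x\<close>, because singletons need not be Borel in a general topological
  space.\<close>

lemma emeasure_chain_law_Int_0:
  assumes tk: "transition_kernel P" and D[measurable]: "D \<in> sets borel" and E[measurable]: "E \<in> sets path_space"
  shows "emeasure (chain_law P x) {\<omega>. \<omega> 0 \<in> D \<and> \<omega> \<in> E} = indicator D x * emeasure (chain_law P x) E"
proof -
  note [measurable_cong] = sets_chain_law[OF tk]
  interpret prob_space "chain_law P x" by (rule prob_space_chain_law[OF tk])
  have D0: "{\<omega>. \<omega> 0 \<in> C} \<in> sets path_space" if [measurable]: "C \<in> sets borel" for C :: "'a set"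
    by (rule sets_path_spaceI) measurable
  have z: "emeasure (chain_law P x) {\<omega>. \<omega> 0 \<in> C} = indicator C x" if C[measurable]: "C \<in> sets borel" for C
  proof -
    have "emeasure (chain_law P x) {\<omega>. \<omega> 0 \<in> C} = (\<integral>\<^sup>+\<omega>. indicator C (\<omega> 0) \<partial>chain_law P x)"
      using D0[OF C] by (subst nn_integral_indicator[symmetric])
        (auto simp: sets_chain_law[OF tk] simp del: nn_integral_indicator intro!: nn_integral_cong split: split_indicator)
    then show ?thesis by (simp add: nn_integral_chain_law_0[OF tk])
  qed
  show ?thesis
  proof (cases "x \<in> D")
    case True
    have "{\<omega>. \<omega> 0 \<in> - D} \<in> null_sets (chain_law P x)"
      using z[of "- D"] D0[of "- D"] True by (auto simp: null_sets_def sets_chain_law[OF tk])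
    then have "AE \<omega> in chain_law P x. \<omega> 0 \<in> D"
      by (rule AE_I') auto
    then have "emeasure (chain_law P x) {\<omega>. \<omega> 0 \<in> D \<and> \<omega> \<in> E} = emeasure (chain_law P x) E"
      using sets_path_spaceI[of "\<lambda>\<omega>. \<omega> 0 \<in> D \<and> \<omega> \<in> E"] E
      by (intro emeasure_eq_AE) (auto simp: sets_chain_law[OF tk])
    then show ?thesis using True by simp
  next
    case False
    have "emeasure (chain_law P x) {\<omega>. \<omega> 0 \<in> D \<and> \<omega> \<in> E} \<le> emeasure (chain_law P x) {\<omega>. \<omega> 0 \<in> D}"
      using D0[OF D] by (intro emeasure_mono) (auto simp: sets_chain_law[OF tk])
    then show ?thesis using False z[OF D] by simp
  qed
qed

lemma measurable_shift: "(\<lambda>\<omega> n. \<omega> (Suc n)) \<in> path_space \<rightarrow>\<^sub>M (path_space :: (nat \<Rightarrow> 'a::topological_space) measure)"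
  by (rule measurable_PiM_single') auto

lemma emeasure_chain_law_shift:
  assumes tk: "transition_kernel P" and E[measurable]: "E \<in> sets path_space"
  shows "emeasure (chain_law P x) {\<omega>. (\<lambda>n. \<omega> (Suc n)) \<in> E} = (\<integral>\<^sup>+y. emeasure (chain_law P y) E \<partial>P x)"
proof -
  have "{\<omega>. (\<lambda>n. \<omega> (Suc n)) \<in> E} \<in> sets path_space"
    using measurable_sets[OF measurable_shift E] by (simp add: vimage_def)
  from chain_law_one_step[OF tk this, of x] show ?thesis by simp
qed

lemma space_mu: "sets \<mu> = sets borel \<Longrightarrow> space \<mu> = UNIV"
  using sets_eq_imp_space_eq[of \<mu> borel] by simp

lemma sets_kernel_bind:
  assumes "sets \<mu> = sets borel" "\<And>x. sets (P x) = sets N"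
  shows "sets (\<mu> \<bind> P) = sets N"
  by (rule sets_bind) (auto simp: assms space_mu)

lemma emeasure_density_bind:
  assumes sm: "sets \<mu> = sets borel" and h: "h \<in> borel_measurable borel"
    and K: "K \<in> borel \<rightarrow>\<^sub>M subprob_algebra N" and D: "D \<in> sets N"
  shows "emeasure (density \<mu> h \<bind> K) D = (\<integral>\<^sup>+x. h x * emeasure (K x) D \<partial>\<mu>)"
proof -
  have h': "h \<in> borel_measurable \<mu>"
    using h by (simp add: measurable_cong_sets[OF sm refl])
  have e: "(\<lambda>x. emeasure (K x) D) \<in> borel_measurable \<mu>"
    using measurable_compose[OF K measurable_emeasure_subprob_algebra[OF D]]
    by (simp add: measurable_cong_sets[OF sm refl])
  have "K \<in> density \<mu> h \<rightarrow>\<^sub>M subprob_algebra N"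
    using K by (simp add: measurable_cong_sets[OF sm refl])
  then have "emeasure (density \<mu> h \<bind> K) D = (\<integral>\<^sup>+x. emeasure (K x) D \<partial>density \<mu> h)"
    by (intro emeasure_bind[OF _ _ D]) (simp_all add: space_mu[OF sm])
  also have "\<dots> = (\<integral>\<^sup>+x. h x * emeasure (K x) D \<partial>\<mu>)"
    by (rule nn_integral_density[OF h' e])
  finally show ?thesis .
qed

context
  fixes P :: "'a::topological_space \<Rightarrow> 'a measure" and \<mu> :: "'a measure"
  assumes tk: "transition_kernel P" and sets_\<mu>[measurable_cong]: "sets \<mu> = sets borel"
begin

lemma emeasure_path_measure_step:
  assumes D[measurable]: "D \<in> sets borel" and E[measurable]: "E \<in> sets path_space"
  shows "emeasure (chain_law_from P \<mu>) {\<omega>. \<omega> 0 \<in> D \<and> (\<lambda>n. \<omega> (Suc n)) \<in> E} =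
    (\<integral>\<^sup>+x. indicator D x * (\<integral>\<^sup>+y. emeasure (chain_law P y) E \<partial>P x) \<partial>\<mu>)"
proof -
  have s[measurable]: "{\<omega>. (\<lambda>n. \<omega> (Suc n)) \<in> E} \<in> sets path_space"
    using measurable_sets[OF measurable_shift E] by (simp add: vimage_def)
  have "{\<omega>. \<omega> 0 \<in> D \<and> \<omega> \<in> {\<omega>. (\<lambda>n. \<omega> (Suc n)) \<in> E}} \<in> sets path_space"
    by (rule sets_path_spaceI) measurable
  then have "emeasure (chain_law_from P \<mu>) {\<omega>. \<omega> 0 \<in> D \<and> (\<lambda>n. \<omega> (Suc n)) \<in> E} =
    (\<integral>\<^sup>+x. emeasure (chain_law P x) {\<omega>. \<omega> 0 \<in> D \<and> \<omega> \<in> {\<omega>. (\<lambda>n. \<omega> (Suc n)) \<in> E}} \<partial>\<mu>)"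
    by (simp add: emeasure_chain_law_from_borel[OF tk sets_\<mu>])
  also have "\<dots> = (\<integral>\<^sup>+x. indicator D x * (\<integral>\<^sup>+y. emeasure (chain_law P y) E \<partial>P x) \<partial>\<mu>)"
    by (simp only: emeasure_chain_law_Int_0[OF tk D s] emeasure_chain_law_shift[OF tk E])
  finally show ?thesis .
qed

lemma emeasure_path_measure_01:
  assumes D[measurable]: "D \<in> sets borel" and B[measurable]: "B \<in> sets borel"
  shows "emeasure (chain_law_from P \<mu>) {\<omega>. \<omega> 0 \<in> D \<and> \<omega> 1 \<in> B} = (\<integral>\<^sup>+x. indicator D x * emeasure (P x) B \<partial>\<mu>)"
proof -
  have B0: "{\<omega>. \<omega> 0 \<in> B \<and> \<omega> \<in> UNIV} \<in> sets path_space"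
    by (rule sets_path_spaceI) measurable
  have U: "(UNIV :: (nat \<Rightarrow> 'a) set) \<in> sets path_space"
    using sets.top[of path_space] by simp
  have "(\<integral>\<^sup>+y. emeasure (chain_law P y) {\<omega>. \<omega> 0 \<in> B \<and> \<omega> \<in> UNIV} \<partial>P x) = emeasure (P x) B" for x
    using prob_space.emeasure_space_1[OF prob_space_chain_law[OF tk]]
    unfolding emeasure_chain_law_Int_0[OF tk B U] space_chain_law[OF tk]
    by (simp add: transition_kernelD(3)[OF tk])
  then show ?thesis
    using emeasure_path_measure_step[OF D B0] by simp
qed

lemma emeasure_path_measure_0:
  assumes D[measurable]: "D \<in> sets borel"
  shows "emeasure (chain_law_from P \<mu>) {\<omega>. \<omega> 0 \<in> D} = emeasure \<mu> D"
  using emeasure_path_measure_01[OF D, of UNIV] prob_space.emeasure_space_1[OF transition_kernelD(2)[OF tk]]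
  by (simp add: transition_kernelD(4)[OF tk] sets_\<mu>)

text \<open>Writing the entrance measure as a restriction of a \<open>bind\<close> supplies
  countable additivity and the integration rules, neither of which \<open>measure_of\<close> gives
  directly.\<close>

lemma mu_entr_eq:
  assumes A[measurable]: "A \<in> sets borel"
  shows "mu_entr P \<mu> A = restrict_space (density \<mu> (indicator (- A)) \<bind> P) A"
proof -
  let ?N = "density \<mu> (indicator (- A)) \<bind> P"
  have sN[measurable_cong]: "sets ?N = sets borel"
    by (rule sets_kernel_bind) (simp_all add: sets_\<mu> transition_kernelD(3)[OF tk])
  have sp: "space ?N = UNIV" using sets_eq_imp_space_eq[OF sN] by simp
  have N: "emeasure ?N B = (\<integral>\<^sup>+x\<in>- A. emeasure (P x) B \<partial>\<mu>)" if B: "B \<in> sets borel" for B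
  proof -
    have "emeasure ?N B = (\<integral>\<^sup>+x. indicator (- A) x * emeasure (P x) B \<partial>\<mu>)"
      by (rule emeasure_density_bind[OF sets_\<mu> _ transition_kernelD(1)[OF tk] B]) measurable
    then show ?thesis by (simp add: mult.commute)
  qed
  have sr: "sets (restrict_space ?N A) = sets (restrict_space borel A)"
    by (rule sets_restrict_space_cong[OF sN])
  have spr: "space (restrict_space ?N A) = A"
    by (simp add: space_restrict_space sp)
  have "mu_entr P \<mu> A = measure_of A (sets (restrict_space borel A)) (emeasure (restrict_space ?N A))"
    unfolding mu_entr_def
  proof (rule measure_of_eq)
    show *: "sets (restrict_space borel A) \<subseteq> Pow A"
      using sets.space_closed[of "restrict_space borel A"] by (simp add: space_restrict_space)
    fix B assume "B \<in> sigma_sets A (sets (restrict_space borel A))"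
    then have "B \<in> sets (restrict_space borel A)"
      using sets.sigma_sets_eq[of "restrict_space borel A"] by (simp add: space_restrict_space)
    then have B: "B \<in> sets borel" "B \<subseteq> A"
      by (auto simp: sets_restrict_space_iff)
    then show "(\<integral>\<^sup>+x\<in>- A. emeasure (chain_law P x) {\<omega>. \<omega> 1 \<in> B} \<partial>\<mu>) = emeasure (restrict_space ?N A) B"
      unfolding emeasure_chain_law_1[OF tk B(1)]
      by (subst emeasure_restrict_space) (auto simp: sN sp N)
  qed
  also have "\<dots> = restrict_space ?N A"
    using measure_of_of_measure[of "restrict_space ?N A"] by (simp only: sr spr)
  finally show ?thesis .
qed

lemma sets_mu_entr: "A \<in> sets borel \<Longrightarrow> sets (mu_entr P \<mu> A) = sets (restrict_space borel A)"
  unfolding mu_entr_eq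
  by (rule sets_restrict_space_cong, rule sets_bind) (auto simp: space_mu[OF sets_\<mu>] transition_kernelD(3)[OF tk])

lemma nn_integral_mu_entr:
  assumes A[measurable]: "A \<in> sets borel" and f[measurable]: "f \<in> borel_measurable borel"
  shows "(\<integral>\<^sup>+x. f x \<partial>mu_entr P \<mu> A) = (\<integral>\<^sup>+x. indicator (- A) x * (\<integral>\<^sup>+y. f y * indicator A y \<partial>P x) \<partial>\<mu>)"
proof -
  let ?N = "density \<mu> (indicator (- A)) \<bind> P"
  have kP: "P \<in> density \<mu> (indicator (- A)) \<rightarrow>\<^sub>M subprob_algebra borel"
    using transition_kernelD(1)[OF tk] by (simp add: measurable_cong_sets[OF sets_\<mu> refl])
  have sN[measurable_cong]: "sets ?N = sets borel"
    by (rule sets_kernel_bind) (simp_all add: sets_\<mu> transition_kernelD(3)[OF tk])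
  have [measurable]: "(\<lambda>x. \<integral>\<^sup>+y. f y * indicator A y \<partial>P x) \<in> borel_measurable borel"
    by (rule nn_integral_P_measurable[OF tk]) measurable
  have "(\<integral>\<^sup>+x. f x \<partial>mu_entr P \<mu> A) = (\<integral>\<^sup>+x. f x * indicator A x \<partial>?N)"
    unfolding mu_entr_eq[OF A] by (rule nn_integral_restrict_space) (auto simp: sN)
  also have "\<dots> = (\<integral>\<^sup>+x. (\<integral>\<^sup>+y. f y * indicator A y \<partial>P x) \<partial>density \<mu> (indicator (- A)))"
    by (rule nn_integral_bind[OF _ kP]) measurable
  also have "\<dots> = (\<integral>\<^sup>+x. indicator (- A) x * (\<integral>\<^sup>+y. f y * indicator A y \<partial>P x) \<partial>\<mu>)"
    by (rule nn_integral_density) measurable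
  finally show ?thesis .
qed

lemma emeasure_mu_entr:
  assumes A[measurable]: "A \<in> sets borel" and B: "B \<in> sets borel" "B \<subseteq> A"
  shows "emeasure (mu_entr P \<mu> A) B = (\<integral>\<^sup>+x. indicator (- A) x * emeasure (P x) B \<partial>\<mu>)"
proof -
  have [measurable]: "B \<in> sets borel" by fact
  have "emeasure (mu_entr P \<mu> A) B = (\<integral>\<^sup>+x. indicator B x \<partial>mu_entr P \<mu> A)"
    using B by (simp add: sets_mu_entr[OF A] sets_restrict_space_iff)
  also have "\<dots> = (\<integral>\<^sup>+x. indicator (- A) x * (\<integral>\<^sup>+y. indicator B y * indicator A y \<partial>P x) \<partial>\<mu>)"
    by (rule nn_integral_mu_entr) measurable
  also have "(\<lambda>y. indicator B y * indicator A y :: ennreal) = indicator B"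
    using B(2) by (auto simp: fun_eq_iff split: split_indicator)
  finally show ?thesis using B(1) by (simp add: transition_kernelD(3)[OF tk])
qed

text \<open>A path started from the entrance measure is a path under \<mu> with a crossing at step
  0, seen from time 1 on. Statements about \<open>mu_entr\<close> thereby become statements about
  the path law to which time reversal applies.\<close>

lemma emeasure_chain_law_from_mu_entr:
  assumes A[measurable]: "A \<in> sets borel" and E[measurable]: "E \<in> sets path_space"
  shows "emeasure (chain_law_from P (mu_entr P \<mu> A)) E =
    emeasure (chain_law_from P \<mu>) {\<omega>. crossing A \<omega> 0 \<and> (\<lambda>n. \<omega> (Suc n)) \<in> E}"
proof -
  have E': "{\<omega>. \<omega> 0 \<in> A \<and> \<omega> \<in> E} \<in> sets path_space"
    by (rule sets_path_spaceI) measurable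
  have "emeasure (chain_law_from P (mu_entr P \<mu> A)) E = (\<integral>\<^sup>+x. emeasure (chain_law P x) E \<partial>mu_entr P \<mu> A)"
    by (rule emeasure_chain_law_from[OF tk sets_mu_entr[OF A] E])
  also have "\<dots> = (\<integral>\<^sup>+x. indicator (- A) x * (\<integral>\<^sup>+y. emeasure (chain_law P y) E * indicator A y \<partial>P x) \<partial>\<mu>)"
    by (rule nn_integral_mu_entr[OF A emeasure_chain_law_measurable[OF tk E]])
  also have "\<dots> = (\<integral>\<^sup>+x. indicator (- A) x * (\<integral>\<^sup>+y. emeasure (chain_law P y) {\<omega>. \<omega> 0 \<in> A \<and> \<omega> \<in> E} \<partial>P x) \<partial>\<mu>)"
    by (simp add: emeasure_chain_law_Int_0[OF tk A E] mult.commute)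
  also have "\<dots> = emeasure (chain_law_from P \<mu>)
      {\<omega>. \<omega> 0 \<in> - A \<and> (\<lambda>n. \<omega> (Suc n)) \<in> {\<omega>. \<omega> 0 \<in> A \<and> \<omega> \<in> E}}"
    by (rule emeasure_path_measure_step[symmetric, OF _ E']) measurable
  finally show ?thesis by (simp add: crossing_def conj_ac)
qed

end

section \<open>Duality and time reversal\<close>

text \<open>The measure \<mu>(dx) P(x,dy) as an object, so that duality can be integrated against
  and can be tested on rectangles.\<close>

definition joint_measure ::
  "'a::topological_space measure \<Rightarrow> ('a \<Rightarrow> 'a measure) \<Rightarrow> ('a \<times> 'a) measure" where
  "joint_measure \<mu> P = \<mu> \<bind> (\<lambda>x. distr (P x) (borel \<Otimes>\<^sub>M borel) (Pair x))"

context
  fixes P :: "'a::topological_space \<Rightarrow> 'a measure" and \<mu> :: "'a measure"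
  assumes tk: "transition_kernel P" and sm: "sets \<mu> = sets borel"
begin

lemma measurable_Pair_kernel: "Pair x \<in> P x \<rightarrow>\<^sub>M borel \<Otimes>\<^sub>M borel"
  by (simp add: measurable_cong_sets[OF transition_kernelD(3)[OF tk] refl])

lemma joint_kernel:
  "(\<lambda>x. distr (P x) (borel \<Otimes>\<^sub>M borel) (Pair x)) \<in> \<mu> \<rightarrow>\<^sub>M subprob_algebra (borel \<Otimes>\<^sub>M borel)"
  unfolding measurable_cong_sets[OF sm refl]
  by (rule measurable_distr2[OF _ transition_kernelD(1)[OF tk]]) simp

lemma sets_joint_measure: "sets (joint_measure \<mu> P) = sets (borel \<Otimes>\<^sub>M borel)"
  unfolding joint_measure_def by (rule sets_bind) (auto simp: space_mu[OF sm])

lemma emeasure_joint_measure: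
  assumes E: "E \<in> sets (borel \<Otimes>\<^sub>M borel)"
  shows "emeasure (joint_measure \<mu> P) E = (\<integral>\<^sup>+x. emeasure (P x) {y. (x, y) \<in> E} \<partial>\<mu>)"
proof -
  have "emeasure (distr (P x) (borel \<Otimes>\<^sub>M borel) (Pair x)) E = emeasure (P x) {y. (x, y) \<in> E}" for x
    by (simp add: emeasure_distr[OF measurable_Pair_kernel E] vimage_def transition_kernelD(4)[OF tk])
  then show ?thesis
    unfolding joint_measure_def by (subst emeasure_bind[OF _ joint_kernel E]) (auto simp: space_mu[OF sm])
qed

lemma nn_integral_joint_measure:
  assumes f: "f \<in> borel_measurable borel" and g: "g \<in> borel_measurable borel"
  shows "(\<integral>\<^sup>+z. f (fst z) * g (snd z) \<partial>joint_measure \<mu> P) = (\<integral>\<^sup>+x. f x * (\<integral>\<^sup>+y. g y \<partial>P x) \<partial>\<mu>)"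
proof -
  note [measurable] = f g
  have fg: "(\<lambda>z. f (fst z) * g (snd z)) \<in> borel_measurable (borel \<Otimes>\<^sub>M borel)"
    by measurable
  show ?thesis
    unfolding joint_measure_def
    by (subst nn_integral_bind[OF fg joint_kernel], intro nn_integral_cong, subst nn_integral_distr[OF measurable_Pair_kernel])
       (simp_all add: fg g nn_integral_cmult measurable_cong_sets[OF transition_kernelD(3)[OF tk] refl])
qed

end

lemma dual_kernels_iff:
  assumes tk: "transition_kernel P" "transition_kernel P'" and sm: "sets \<mu> = sets borel"
  shows "dual_kernels \<mu> P P' \<longleftrightarrow>
    joint_measure \<mu> P = distr (joint_measure \<mu> P') (borel \<Otimes>\<^sub>M borel) prod.swap"
proof -
  have swap: "prod.swap \<in> borel \<Otimes>\<^sub>M borel \<rightarrow>\<^sub>M (borel \<Otimes>\<^sub>M borel :: ('a \<times> 'a) measure)"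
    unfolding prod.swap_def by measurable
  then have swap': "prod.swap \<in> joint_measure \<mu> P' \<rightarrow>\<^sub>M borel \<Otimes>\<^sub>M borel"
    by (simp add: measurable_cong_sets[OF sets_joint_measure[OF tk(2) sm] refl])
  have sp: "space (joint_measure \<mu> P') = UNIV"
    using sets_eq_imp_space_eq[OF sets_joint_measure[OF tk(2) sm]] by (simp add: space_pair_measure)
  have r: "emeasure (distr (joint_measure \<mu> P') (borel \<Otimes>\<^sub>M borel) prod.swap) E =
      (\<integral>\<^sup>+y. emeasure (P' y) {x. (x, y) \<in> E} \<partial>\<mu>)"
    if E: "E \<in> sets (borel \<Otimes>\<^sub>M borel)" for E
  proof -
    have "prod.swap -` E \<in> sets (borel \<Otimes>\<^sub>M borel)"
      using measurable_sets[OF swap E] by (simp add: space_pair_measure)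
    then show ?thesis
      by (simp add: emeasure_distr[OF swap' E] sp emeasure_joint_measure[OF tk(2) sm])
  qed
  show ?thesis
  proof
    assume dual: "dual_kernels \<mu> P P'"
    show "joint_measure \<mu> P = distr (joint_measure \<mu> P') (borel \<Otimes>\<^sub>M borel) prod.swap"
    proof (rule measure_eqI)
      fix E assume "E \<in> sets (joint_measure \<mu> P)"
      then have E: "E \<in> sets (borel \<Otimes>\<^sub>M borel)" by (simp add: sets_joint_measure[OF tk(1) sm])
      show "emeasure (joint_measure \<mu> P) E = emeasure (distr (joint_measure \<mu> P') (borel \<Otimes>\<^sub>M borel) prod.swap) E"
        unfolding r[OF E] emeasure_joint_measure[OF tk(1) sm E] using dual E by (simp add: dual_kernels_def)
    qed (simp add: sets_joint_measure[OF tk(1) sm])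
  next
    assume eq: "joint_measure \<mu> P = distr (joint_measure \<mu> P') (borel \<Otimes>\<^sub>M borel) prod.swap"
    show "dual_kernels \<mu> P P'"
      unfolding dual_kernels_def
    proof
      fix E assume E: "E \<in> sets (borel \<Otimes>\<^sub>M borel :: ('a \<times> 'a) measure)"
      show "(\<integral>\<^sup>+x. emeasure (P x) {y. (x, y) \<in> E} \<partial>\<mu>) = (\<integral>\<^sup>+y. emeasure (P' y) {x. (x, y) \<in> E} \<partial>\<mu>)"
        unfolding r[OF E, symmetric] eq[symmetric] by (rule emeasure_joint_measure[OF tk(1) sm E, symmetric])
    qed
  qed
qed

text \<open>The two kernels are adjoint for the pairing of nonnegative functions under \<mu>; this
  is the form of duality that the later proofs use.\<close>

lemma dual_kernels_nn_integral:
  assumes tk: "transition_kernel P" "transition_kernel P'" and sm: "sets \<mu> = sets borel"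
    and dual: "dual_kernels \<mu> P P'"
    and f[measurable]: "f \<in> borel_measurable borel" and g[measurable]: "g \<in> borel_measurable borel"
  shows "(\<integral>\<^sup>+x. f x * (\<integral>\<^sup>+y. g y \<partial>P x) \<partial>\<mu>) = (\<integral>\<^sup>+y. g y * (\<integral>\<^sup>+x. f x \<partial>P' y) \<partial>\<mu>)"
proof -
  have swap: "prod.swap \<in> joint_measure \<mu> P' \<rightarrow>\<^sub>M borel \<Otimes>\<^sub>M borel"
    unfolding prod.swap_def measurable_cong_sets[OF sets_joint_measure[OF tk(2) sm] refl] by measurable
  have "(\<integral>\<^sup>+x. f x * (\<integral>\<^sup>+y. g y \<partial>P x) \<partial>\<mu>) = (\<integral>\<^sup>+z. f (fst z) * g (snd z) \<partial>joint_measure \<mu> P)"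
    by (rule nn_integral_joint_measure[OF tk(1) sm f g, symmetric])
  also have "\<dots> = (\<integral>\<^sup>+z. g (fst z) * f (snd z) \<partial>joint_measure \<mu> P')"
    unfolding dual[unfolded dual_kernels_iff[OF tk sm]]
    by (subst nn_integral_distr[OF swap]) (auto simp: mult.commute)
  also have "\<dots> = (\<integral>\<^sup>+y. g y * (\<integral>\<^sup>+x. f x \<partial>P' y) \<partial>\<mu>)"
    by (rule nn_integral_joint_measure[OF tk(2) sm g f])
  finally show ?thesis .
qed

section \<open>Time reversal of the path law\<close>

locale dual_chains =
  fixes P P' :: "'a::topological_space \<Rightarrow> 'a measure" and \<mu> :: "'a measure"
  assumes tk: "transition_kernel P" and tk': "transition_kernel P'"
    and sets_mu[measurable_cong]: "sets \<mu> = sets borel"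
    and sigma_finite: "sigma_finite_measure \<mu>"
    and dual: "dual_kernels \<mu> P P'"
begin

text \<open>At the current point \<open>x\<close>, the sets \<open>S # Ss\<close> lie ahead for
  \<open>P\<close> and the sets \<open>Ts\<close> lie ahead for \<open>P'\<close>. Each use of
  adjointness moves the current point one step along \<open>Ss\<close> and hands the set just left
  over to the \<open>P'\<close> side, so that the order is reversed.\<close>

lemma nn_integral_path_int_reverse:
  assumes "S \<in> sets borel" "set Ss \<subseteq> sets borel" "set Ts \<subseteq> sets borel"
  shows "(\<integral>\<^sup>+x. path_int P (S # Ss) (\<lambda>_. 1) x * (\<integral>\<^sup>+y. path_int P' Ts (\<lambda>_. 1) y \<partial>P' x) \<partial>\<mu>) =
    (\<integral>\<^sup>+x. path_int P' (rev Ss @ S # Ts) (\<lambda>_. 1) x \<partial>\<mu>)"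
  using assms
proof (induction Ss arbitrary: S Ts)
  case Nil
  show ?case
    using prob_space.emeasure_space_1[OF transition_kernelD(2)[OF tk]] by simp
next
  case (Cons S1 Ss)
  have "(\<integral>\<^sup>+x. path_int P (S # S1 # Ss) (\<lambda>_. 1) x * (\<integral>\<^sup>+y. path_int P' Ts (\<lambda>_. 1) y \<partial>P' x) \<partial>\<mu>) =
      (\<integral>\<^sup>+x. path_int P' (S # Ts) (\<lambda>_. 1) x * (\<integral>\<^sup>+y. path_int P (S1 # Ss) (\<lambda>_. 1) y \<partial>P x) \<partial>\<mu>)"
    by (simp add: ac_simps)
  also have "\<dots> = (\<integral>\<^sup>+y. path_int P (S1 # Ss) (\<lambda>_. 1) y * (\<integral>\<^sup>+x. path_int P' (S # Ts) (\<lambda>_. 1) x \<partial>P' y) \<partial>\<mu>)"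
    using Cons.prems
    by (intro dual_kernels_nn_integral[OF tk tk' sets_mu dual] path_int_measurable tk tk') auto
  also have "\<dots> = (\<integral>\<^sup>+x. path_int P' (rev Ss @ S1 # S # Ts) (\<lambda>_. 1) x \<partial>\<mu>)"
    using Cons.prems by (intro Cons.IH) auto
  finally show ?case by simp
qed

lemma cylinder_reverse:
  assumes S: "\<And>i. S i \<in> sets borel"
  shows "emeasure (chain_law_from P \<mu>) {\<omega>. \<forall>i<Suc n. \<omega> i \<in> S i} =
    emeasure (chain_law_from P' \<mu>) {\<omega>. \<forall>i<Suc n. \<omega> i \<in> S (n - i)}"
proof -
  have l: "map S [0..<Suc n] = S 0 # map (\<lambda>i. S (Suc i)) [0..<n]"
    by (simp add: map_upt_Suc del: upt_Suc)
  have r: "rev (map S [0..<Suc n]) = map (\<lambda>i. S (n - i)) [0..<Suc n]"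
    by (rule nth_equalityI) (auto simp: rev_nth simp del: upt_Suc)
  have "emeasure (chain_law_from P \<mu>) {\<omega>. \<forall>i<Suc n. \<omega> i \<in> S i} =
      (\<integral>\<^sup>+x. path_int P (map S [0..<Suc n]) (\<lambda>_. 1) x \<partial>\<mu>)"
    using emeasure_chain_law_cylinder[OF tk S]
    by (subst emeasure_chain_law_from_borel[OF tk sets_mu cylinders_sets[OF cylindersI]]) (auto intro: S)
  \<comment> \<open>Nothing has been reversed at the start: \<open>Ts\<close> is empty and its
    factor is the total mass 1 of \<open>P'\<close>.\<close>
  also have "\<dots> = (\<integral>\<^sup>+x. path_int P' (rev (map S [0..<Suc n])) (\<lambda>_. 1) x \<partial>\<mu>)"
    using nn_integral_path_int_reverse[of "S 0" "map (\<lambda>i. S (Suc i)) [0..<n]" "[]"] S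
      prob_space.emeasure_space_1[OF transition_kernelD(2)[OF tk']]
    by (simp add: l image_subset_iff del: upt_Suc path_int.simps(2))
  also have "\<dots> = emeasure (chain_law_from P' \<mu>) {\<omega>. \<forall>i<Suc n. \<omega> i \<in> S (n - i)}"
    using emeasure_chain_law_cylinder[OF tk', of "\<lambda>i. S (n - i)"] S unfolding r
    by (subst emeasure_chain_law_from_borel[OF tk' sets_mu cylinders_sets[OF cylindersI]]) (auto intro: S)
  finally show ?thesis .
qed

text \<open>\<open>min i n\<close> freezes the path after time \<open>n\<close>, and truncated
  subtraction in \<open>n - i\<close> freezes the reversed path after time \<open>n\<close>. Both
  events thus depend on \<open>n + 1\<close> coordinates only, and the laws of these vectors agree
  on rectangles.\<close>

lemma emeasure_reverse:
  assumes E[measurable]: "E \<in> sets path_space"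
  shows "emeasure (chain_law_from P \<mu>) {\<omega>. (\<lambda>i. \<omega> (min i n)) \<in> E} =
    emeasure (chain_law_from P' \<mu>) {\<omega>. (\<lambda>i. \<omega> (n - i)) \<in> E}"
proof -
  let ?M = "PiM {..n} (\<lambda>_. borel :: 'a measure)"
  let ?Q = "distr (chain_law_from P \<mu>) ?M (\<lambda>\<omega>. \<lambda>i\<in>{..n}. \<omega> i)"
  let ?Q' = "distr (chain_law_from P' \<mu>) ?M (\<lambda>\<omega>. \<lambda>i\<in>{..n}. \<omega> (n - i))"
  have m: "(\<lambda>\<omega>. \<lambda>i\<in>{..n}. \<omega> i) \<in> chain_law_from P \<mu> \<rightarrow>\<^sub>M ?M"
    unfolding measurable_cong_sets[OF sets_chain_law_from refl] by (rule measurable_restrict) auto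
  have m': "(\<lambda>\<omega>. \<lambda>i\<in>{..n}. \<omega> (n - i)) \<in> chain_law_from P' \<mu> \<rightarrow>\<^sub>M ?M"
    unfolding measurable_cong_sets[OF sets_chain_law_from refl] by (rule measurable_restrict) auto
  have Q: "emeasure ?Q (Pi\<^sub>E {..n} S) = emeasure (chain_law_from P \<mu>) {\<omega>. \<forall>i<Suc n. \<omega> i \<in> S i}"
    if S: "\<And>i. S i \<in> sets borel" for S
  proof -
    have "Pi\<^sub>E {..n} S \<in> sets ?M" by (rule sets_PiM_I_finite) (auto simp: S)
    moreover have "(\<lambda>\<omega>. \<lambda>i\<in>{..n}. \<omega> i) -` Pi\<^sub>E {..n} S \<inter> UNIV = {\<omega>. \<forall>i<Suc n. \<omega> i \<in> S i}"
      by (auto simp: PiE_iff less_Suc_eq_le)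
    ultimately show ?thesis by (simp add: emeasure_distr[OF m] del: Int_UNIV_right)
  qed
  have Q': "emeasure ?Q' (Pi\<^sub>E {..n} S) = emeasure (chain_law_from P' \<mu>) {\<omega>. \<forall>i<Suc n. \<omega> i \<in> S (n - i)}"
    if S: "\<And>i. S i \<in> sets borel" for S
  proof -
    have rev_iff: "(\<forall>i\<le>n. \<omega> (n - i) \<in> S i) \<longleftrightarrow> (\<forall>i\<le>n. \<omega> i \<in> S (n - i))" for \<omega> :: "nat \<Rightarrow> 'a"
    proof (intro iffI allI impI)
      fix i assume "\<forall>i\<le>n. \<omega> (n - i) \<in> S i" "i \<le> n"
      from this(1)[rule_format, of "n - i"] this(2) show "\<omega> i \<in> S (n - i)" by simp
    next
      fix i assume "\<forall>i\<le>n. \<omega> i \<in> S (n - i)" "i \<le> n"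
      from this(1)[rule_format, of "n - i"] this(2) show "\<omega> (n - i) \<in> S i" by simp
    qed
    have "(\<lambda>\<omega>. \<lambda>i\<in>{..n}. \<omega> (n - i)) -` Pi\<^sub>E {..n} S \<inter> UNIV = {\<omega>. \<forall>i<Suc n. \<omega> i \<in> S (n - i)}"
      unfolding set_eq_iff by (simp add: PiE_iff less_Suc_eq_le Ball_def rev_iff)
    moreover have "Pi\<^sub>E {..n} S \<in> sets ?M" by (rule sets_PiM_I_finite) (auto simp: S)
    ultimately show ?thesis by (simp add: emeasure_distr[OF m'] del: Int_UNIV_right)
  qed
  interpret sigma_finite_measure \<mu> by (rule sigma_finite)
  obtain F :: "nat \<Rightarrow> 'a set" where F: "range F \<subseteq> sets \<mu>" "(\<Union>i. F i) = space \<mu>" "\<And>i. emeasure \<mu> (F i) \<noteq> \<infinity>"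
    using sigma_finite by blast
  have F': "F k \<in> sets borel" for k using F(1) sets_mu by auto
  \<comment> \<open>Restricting coordinate 0 alone to the finite pieces of \<mu> exhausts the
    vectors by rectangles of finite mass.\<close>
  let ?A = "\<lambda>k. Pi\<^sub>E {..n} (\<lambda>i. if i = 0 then F k else UNIV)"
  have "?Q = ?Q'"
  proof (rule measure_eqI_PiM_finite[where I="{..n}" and M="\<lambda>_. borel"])
    fix S :: "nat \<Rightarrow> 'a set" assume S: "\<And>i. i \<in> {..n} \<Longrightarrow> S i \<in> sets borel"
    let ?S = "\<lambda>i. if i \<le> n then S i else UNIV"
    have *: "Pi\<^sub>E {..n} S = Pi\<^sub>E {..n} ?S" by (rule PiE_cong) simp
    have S': "?S i \<in> sets borel" for i using S by simp
    show "emeasure ?Q (Pi\<^sub>E {..n} S) = emeasure ?Q' (Pi\<^sub>E {..n} S)"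
      unfolding * Q[OF S'] Q'[OF S'] by (rule cylinder_reverse[OF S'])
  next
    show "range ?A \<subseteq> prod_algebra {..n} (\<lambda>_. borel)"
      using F' by (auto intro!: prod_algebraI_finite)
    show "(\<Union>k. ?A k) = space ?M"
    proof (intro set_eqI iffI)
      fix \<rho> :: "nat \<Rightarrow> 'a" assume \<rho>: "\<rho> \<in> space ?M"
      have "\<rho> 0 \<in> (\<Union>i. F i)" unfolding F(2) by (simp add: space_mu[OF sets_mu])
      then obtain k where "\<rho> 0 \<in> F k" by blast
      with \<rho> show "\<rho> \<in> (\<Union>k. ?A k)" by (auto simp: space_PiM PiE_iff)
    qed (auto simp: space_PiM PiE_iff)
    fix k
    have "{\<omega>. \<forall>i<Suc n. \<omega> i \<in> (if i = 0 then F k else UNIV)} = {\<omega>. \<omega> 0 \<in> F k}"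
      by (auto split: if_splits)
    then have "emeasure ?Q (?A k) = emeasure \<mu> (F k)"
      using Q[of "\<lambda>i. if i = 0 then F k else UNIV"] F' emeasure_path_measure_0[OF tk sets_mu F'[of k]] by simp
    then show "emeasure ?Q (?A k) \<noteq> \<infinity>" using F(3) by simp
  qed auto
  have ext: "(\<lambda>\<rho> i. \<rho> (min i n)) \<in> ?M \<rightarrow>\<^sub>M path_space"
    by (rule measurable_PiM_single') auto
  let ?E = "(\<lambda>\<rho> i. \<rho> (min i n)) -` E \<inter> space ?M"
  have E': "?E \<in> sets ?M" by (rule measurable_sets[OF ext E])
  have "emeasure ?Q ?E = emeasure (chain_law_from P \<mu>) {\<omega>. (\<lambda>i. \<omega> (min i n)) \<in> E}"
    by (subst emeasure_distr[OF m E']) (auto simp: vimage_def space_PiM intro!: arg_cong2[where f=emeasure])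
  moreover have "n - min i n = n - i" for i by simp
  then have "emeasure ?Q' ?E = emeasure (chain_law_from P' \<mu>) {\<omega>. (\<lambda>i. \<omega> (n - i)) \<in> E}"
    by (subst emeasure_distr[OF m' E']) (auto simp: vimage_def space_PiM intro!: arg_cong2[where f=emeasure])
  ultimately show ?thesis using \<open>?Q = ?Q'\<close> by simp
qed

text \<open>Reversal over the horizon \<open>Suc (Suc n)\<close> turns the crossing at 0 into a
  down-crossing at \<open>Suc n\<close>, the steps without crossing into steps 1, ..., n without
  down-crossing, and the last pair into the first. For general \<open>G\<close> the forward events
  overlap; the reversed ones are disjoint, being indexed by the first down-crossing from time 1
  on.\<close>

lemma crossing_transport:
  assumes A[measurable]: "A \<in> sets borel" and G: "G \<in> sets (borel \<Otimes>\<^sub>M borel)"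
    and osc: "AE \<omega> in chain_law_from P' \<mu>. (\<exists>\<^sub>\<infinity>k. \<omega> k \<in> A) \<and> (\<exists>\<^sub>\<infinity>k. \<omega> k \<in> - A)"
  shows "(\<Sum>n. emeasure (chain_law_from P \<mu>)
      {\<omega>. crossing A \<omega> 0 \<and> (\<forall>i<n. \<not> crossing A \<omega> (Suc i)) \<and> (\<omega> (Suc n), \<omega> (Suc (Suc n))) \<in> G}) =
    emeasure (chain_law_from P \<mu>) {\<omega>. (\<omega> 0, \<omega> 1) \<in> G}"
proof -
  have [measurable]: "Measurable.pred path_space (\<lambda>\<omega> :: nat \<Rightarrow> 'a. (\<omega> a, \<omega> b) \<in> G)" for a b
    using G by measurable
  define down where "down \<omega> j \<longleftrightarrow> \<omega> j \<in> A \<and> \<omega> (Suc j) \<notin> A" for \<omega> :: "nat \<Rightarrow> 'a" and j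
  have [measurable]: "Measurable.pred path_space (\<lambda>\<omega>. down \<omega> j)" for j
    unfolding down_def by measurable
  let ?E = "\<lambda>n. {\<omega>. crossing A \<omega> 0 \<and> (\<forall>i<n. \<not> crossing A \<omega> (Suc i)) \<and> (\<omega> (Suc n), \<omega> (Suc (Suc n))) \<in> G}"
  let ?F = "\<lambda>n. {\<omega>. (\<omega> 1, \<omega> 0) \<in> G \<and> (\<forall>j<n. \<not> down \<omega> (Suc j)) \<and> down \<omega> (Suc n)}"
  have F: "?F n \<in> sets path_space" for n
    by (rule sets_path_spaceI) measurable
  have EF: "emeasure (chain_law_from P \<mu>) (?E n) = emeasure (chain_law_from P' \<mu>) (?F n)" for n
  proof -
    have E: "?E n \<in> sets path_space"
      by (rule sets_path_spaceI) measurable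
    have "{\<omega>. (\<lambda>i. \<omega> (min i (Suc (Suc n)))) \<in> ?E n} = ?E n"
      by (simp add: crossing_def min_def)
    moreover have "{\<omega>. (\<lambda>i. \<omega> (Suc (Suc n) - i)) \<in> ?E n} = ?F n"
    proof (rule Collect_cong)
      fix \<omega> :: "nat \<Rightarrow> 'a"
      \<comment> \<open>The index change is \<open>i = n - Suc j\<close>, its own inverse on the
        numbers below \<open>n\<close>.\<close>
      have "(\<forall>i<n. \<not> (\<omega> (Suc n - i) \<notin> A \<and> \<omega> (n - i) \<in> A)) \<longleftrightarrow> (\<forall>j<n. \<not> down \<omega> (Suc j))" (is "?l \<longleftrightarrow> ?r")
      proof (intro iffI allI impI)
        fix j assume ?l "j < n"
        then have "\<not> (\<omega> (Suc n - (n - Suc j)) \<notin> A \<and> \<omega> (n - (n - Suc j)) \<in> A)"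
          by (intro \<open>?l\<close>[rule_format]) simp
        moreover have "Suc n - (n - Suc j) = Suc (Suc j)" "n - (n - Suc j) = Suc j" using \<open>j < n\<close> by auto
        ultimately show "\<not> down \<omega> (Suc j)" by (auto simp: down_def)
      next
        fix i assume ?r "i < n"
        then have "\<not> down \<omega> (Suc (n - Suc i))"
          by (intro \<open>?r\<close>[rule_format]) simp
        moreover have "Suc (n - Suc i) = n - i" "Suc (n - i) = Suc n - i" using \<open>i < n\<close> by auto
        ultimately show "\<not> (\<omega> (Suc n - i) \<notin> A \<and> \<omega> (n - i) \<in> A)" by (auto simp: down_def)
      qed
      then show "(\<lambda>i. \<omega> (Suc (Suc n) - i)) \<in> ?E n \<longleftrightarrow>
        (\<omega> 1, \<omega> 0) \<in> G \<and> (\<forall>j<n. \<not> down \<omega> (Suc j)) \<and> down \<omega> (Suc n)"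
        by (auto simp: crossing_def down_def)
    qed
    ultimately show ?thesis
      using emeasure_reverse[OF E, of "Suc (Suc n)"] by simp
  qed
  have "(\<Sum>n. emeasure (chain_law_from P \<mu>) (?E n)) = (\<Sum>n. emeasure (chain_law_from P' \<mu>) (?F n))"
    unfolding EF ..
  also have "\<dots> = emeasure (chain_law_from P' \<mu>) (\<Union>n. ?F n)"
  proof (rule suminf_emeasure)
    show "disjoint_family ?F"
      unfolding disjoint_family_on_def by (auto, metis linorder_neqE_nat)
  qed (use F in auto)
  also have "\<dots> = emeasure (chain_law_from P' \<mu>) {\<omega>. (\<omega> 1, \<omega> 0) \<in> G}"
  proof (rule emeasure_eq_AE)
    show "AE \<omega> in chain_law_from P' \<mu>. \<omega> \<in> (\<Union>n. ?F n) \<longleftrightarrow> \<omega> \<in> {\<omega>. (\<omega> 1, \<omega> 0) \<in> G}"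
      using osc
    proof eventually_elim
      case (elim \<omega>)
      \<comment> \<open>The visit to \<open>A\<close> must come after time 0, since step 0 is
        reserved for \<open>G\<close> and down-crossings are counted from step 1.\<close>
      then obtain k where k: "k > 0" "\<omega> k \<in> A" unfolding INFM_nat by blast
      from elim obtain l where l: "l > k" "\<omega> l \<notin> A" unfolding INFM_nat by blast
      have "\<exists>j. down \<omega> (Suc j)"
      proof (rule ccontr)
        assume n: "\<nexists>j. down \<omega> (Suc j)"
        have "\<omega> (k + m) \<in> A" for m
        proof (induction m)
          case (Suc m)
          obtain k' where "k = Suc k'" using k(1) by (cases k) auto
          then show ?case using n Suc by (auto simp: down_def)
        qed (simp add: k)
        from this[of "l - k"] show False using l by simp
      qed
      then obtain n where "down \<omega> (Suc n)" "\<forall>j<n. \<not> down \<omega> (Suc j)"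
        using exists_least_iff[of "\<lambda>j. down \<omega> (Suc j)"] by blast
      then show ?case by auto
    qed
    show "(\<Union>n. ?F n) \<in> sets (chain_law_from P' \<mu>)" using F by auto
    show "{\<omega>. (\<omega> 1, \<omega> 0) \<in> G} \<in> sets (chain_law_from P' \<mu>)"
      unfolding sets_chain_law_from by (rule sets_path_spaceI) measurable
  qed
  \<comment> \<open>A second reversal, now over the horizon 1, returns from the dual chain to
    \<open>P\<close>.\<close>
  also have "\<dots> = emeasure (chain_law_from P \<mu>) {\<omega>. (\<omega> 0, \<omega> 1) \<in> G}"
  proof -
    have E: "{\<omega> :: nat \<Rightarrow> 'a. (\<omega> 0, \<omega> 1) \<in> G} \<in> sets path_space"
      by (rule sets_path_spaceI) measurable
    show ?thesis using emeasure_reverse[OF E, of 1] by simp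
  qed
  finally show ?thesis .
qed

end

section \<open>Oscillation between the set and its complement\<close>

text \<open>The hypotheses say that staying on one side from time 0 on is null. Shift invariance
  carries this to every starting time, and a path that fails to oscillate stays on one side from one
  of these countably many times on.\<close>

lemma AE_oscillates:
  fixes P :: "'a::topological_space \<Rightarrow> 'a measure"
  assumes tk: "transition_kernel P" and sets_mu: "sets \<mu> = sets borel"
    and inv: "invariant_measure (\<lambda>x B. emeasure (P x) B) \<mu>" and A[measurable]: "A \<in> sets borel"
    and h1: "emeasure (chain_law_from P (restrict_space \<mu> A)) {\<omega>. hit_time (- A) \<omega> = \<infinity>} = 0"
    and h2: "emeasure (chain_law_from P (restrict_space \<mu> (- A))) {\<omega>. hit_time A \<omega> = \<infinity>} = 0"
  shows "AE \<omega> in chain_law_from P \<mu>. (\<exists>\<^sub>\<infinity>k. \<omega> k \<in> A) \<and> (\<exists>\<^sub>\<infinity>k. \<omega> k \<in> - A)"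
proof -
  have sp: "space \<mu> = UNIV" using sets_eq_imp_space_eq[OF sets_mu] by simp
  have ne: "space \<mu> \<noteq> {}" using sp by simp
  have kP: "P \<in> \<mu> \<rightarrow>\<^sub>M subprob_algebra borel"
    using transition_kernelD(1)[OF tk] by (simp add: measurable_cong_sets[OF sets_mu refl])
  have bind: "\<mu> \<bind> P = \<mu>"
  proof (rule measure_eqI)
    show s: "sets (\<mu> \<bind> P) = sets \<mu>"
      by (subst sets_bind[OF _ ne]) (auto simp: transition_kernelD(3)[OF tk] sets_mu)
    fix B assume "B \<in> sets (\<mu> \<bind> P)"
    then show "emeasure (\<mu> \<bind> P) B = emeasure \<mu> B"
      using inv emeasure_bind[OF ne kP, of B] by (simp add: s sets_mu invariant_measure_def)
  qed
  have shift: "emeasure (chain_law_from P \<mu>) {\<omega>. (\<lambda>n. \<omega> (Suc n)) \<in> E} = emeasure (chain_law_from P \<mu>) E"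
    if E: "E \<in> sets path_space" for E
  proof -
    have "emeasure (chain_law_from P \<mu>) {\<omega>. (\<lambda>n. \<omega> (Suc n)) \<in> E} =
        (\<integral>\<^sup>+x. (\<integral>\<^sup>+y. emeasure (chain_law P y) E \<partial>P x) \<partial>\<mu>)"
      using emeasure_path_measure_step[OF tk sets_mu _ E, of UNIV] by simp
    also have "\<dots> = (\<integral>\<^sup>+y. emeasure (chain_law P y) E \<partial>(\<mu> \<bind> P))"
      by (rule nn_integral_bind[OF emeasure_chain_law_measurable[OF tk E] kP, symmetric])
    also have "\<dots> = emeasure (chain_law_from P \<mu>) E"
      by (simp only: bind emeasure_chain_law_from_borel[OF tk sets_mu E])
    finally show ?thesis .
  qed
  have trap: "{\<omega>. \<forall>k. \<omega> (n + k) \<in> B} \<in> null_sets (chain_law_from P \<mu>)"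
    if B[measurable]: "B \<in> sets borel"
      and h: "emeasure (chain_law_from P (restrict_space \<mu> B)) {\<omega>. hit_time (- B) \<omega> = \<infinity>} = 0" for B n
  proof (induction n)
    case 0
    \<comment> \<open>\<open>hit_time\<close> starts at time 1; that time 0 also lies in
      \<open>B\<close> comes from restricting \<mu> to \<open>B\<close>.\<close>
    have "{\<omega>. hit_time (- B) \<omega> = \<infinity>} = {\<omega>. \<forall>k. \<omega> (Suc k) \<in> B}"
    proof (rule Collect_cong)
      fix \<omega> :: "nat \<Rightarrow> 'a"
      have "hit_time (- B) \<omega> = \<infinity> \<longleftrightarrow> (\<forall>n\<ge>1. \<omega> n \<in> B)"
        unfolding hit_time_def top_enat_def[symmetric] Inf_top_conv by (auto simp: top_enat_def)
      also have "\<dots> \<longleftrightarrow> (\<forall>k. \<omega> (Suc k) \<in> B)"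
        by (metis One_nat_def Suc_le_D le_add1 plus_1_eq_Suc)
      finally show "hit_time (- B) \<omega> = \<infinity> \<longleftrightarrow> (\<forall>k. \<omega> (Suc k) \<in> B)" .
    qed
    moreover have E: "{\<omega>. \<forall>k. \<omega> (Suc k) \<in> B} \<in> sets path_space"
      by (rule sets_path_spaceI) measurable
    ultimately have int0: "(\<integral>\<^sup>+x. emeasure (chain_law P x) {\<omega>. \<forall>k. \<omega> (Suc k) \<in> B} \<partial>restrict_space \<mu> B) = 0"
      using h emeasure_chain_law_from[OF tk sets_restrict_space_cong[OF sets_mu] E] by simp
    have s: "{\<omega>. \<forall>k. \<omega> k \<in> B} \<in> sets path_space"
      by (rule sets_path_spaceI) measurable
    have eq: "{\<omega>. \<forall>k. \<omega> k \<in> B} = {\<omega>. \<omega> 0 \<in> B \<and> \<omega> \<in> {\<omega>. \<forall>k. \<omega> (Suc k) \<in> B}}"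
      by (auto, metis not0_implies_Suc)
    have "emeasure (chain_law_from P \<mu>) {\<omega>. \<forall>k. \<omega> k \<in> B} =
        (\<integral>\<^sup>+x. indicator B x * emeasure (chain_law P x) {\<omega>. \<forall>k. \<omega> (Suc k) \<in> B} \<partial>\<mu>)"
      by (simp only: emeasure_chain_law_from_borel[OF tk sets_mu s]) (simp only: eq emeasure_chain_law_Int_0[OF tk B E])
    also have "\<dots> = (\<integral>\<^sup>+x. emeasure (chain_law P x) {\<omega>. \<forall>k. \<omega> (Suc k) \<in> B} \<partial>restrict_space \<mu> B)"
      using B by (subst nn_integral_restrict_space) (auto simp: sets_mu sp mult.commute)
    finally show ?case using s int0 by (simp add: null_sets_def)
  next
    case (Suc n)
    then have s: "{\<omega>. \<forall>k. \<omega> (n + k) \<in> B} \<in> sets path_space" by (simp add: null_sets_def)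
    have "{\<omega>. \<forall>k. \<omega> (Suc n + k) \<in> B} \<in> sets path_space"
      by (rule sets_path_spaceI) measurable
    with Suc shift[OF s] show ?case by (simp add: null_sets_def)
  qed
  have "AE \<omega> in chain_law_from P \<mu>. \<forall>n. \<not> (\<forall>k. \<omega> (n + k) \<in> A)"
    unfolding AE_all_countable by (intro allI AE_I'[OF trap[OF A h1]]) auto
  moreover have "- A \<in> sets borel" by measurable
  then have trap': "{\<omega>. \<forall>k. \<omega> (n + k) \<in> - A} \<in> null_sets (chain_law_from P \<mu>)" for n
    by (rule trap) (simp add: h2)
  have "AE \<omega> in chain_law_from P \<mu>. \<forall>n. \<not> (\<forall>k. \<omega> (n + k) \<in> - A)"
    unfolding AE_all_countable by (intro allI AE_I'[OF trap']) auto
  ultimately show ?thesis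
  proof eventually_elim
    case (elim \<omega>)
    then show ?case
      unfolding INFM_nat_le by (metis ComplD ComplI le_add1)
  qed
qed

section \<open>Recurrence, invariance and the occupation formula\<close>

lemma osc_sets:
  fixes A :: "'a::topological_space set"
  assumes [measurable]: "A \<in> sets borel"
  shows "{\<omega>. (\<exists>\<^sub>\<infinity>k. \<omega> k \<in> A) \<and> (\<exists>\<^sub>\<infinity>k. \<omega> k \<in> - A)} \<in> sets path_space"
  unfolding INFM_nat by (rule sets_path_spaceI) measurable

lemma recurrent_states_sets:
  fixes A :: "'a::topological_space set"
  assumes tk: "transition_kernel P" and A: "A \<in> sets borel"
  shows "recurrent_states P A \<in> sets borel"
proof -
  note [measurable] = emeasure_chain_law_measurable[OF tk osc_sets[OF A]]
  have "{x \<in> space borel. emeasure (chain_law P x) {\<omega>. (\<exists>\<^sub>\<infinity>k. \<omega> k \<in> A) \<and> (\<exists>\<^sub>\<infinity>k. \<omega> k \<in> - A)} = 1} \<in> sets borel"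
    by measurable
  then show ?thesis by (simp add: recurrent_states_def)
qed

text \<open>The \<mu>-integral of the probability of not oscillating is 0, so this probability
  vanishes at almost every starting point.\<close>

lemma AE_recurrent_states:
  fixes A :: "'a::topological_space set"
  assumes tk: "transition_kernel P" and sets_mu: "sets \<mu> = sets borel" and A: "A \<in> sets borel"
    and osc: "AE \<omega> in chain_law_from P \<mu>. (\<exists>\<^sub>\<infinity>k. \<omega> k \<in> A) \<and> (\<exists>\<^sub>\<infinity>k. \<omega> k \<in> - A)"
  shows "AE x in \<mu>. x \<in> recurrent_states P A"
proof -
  let ?O = "{\<omega>. (\<exists>\<^sub>\<infinity>k. \<omega> k \<in> A) \<and> (\<exists>\<^sub>\<infinity>k. \<omega> k \<in> - A)}"
  have O: "?O \<in> sets path_space" by (rule osc_sets[OF A])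
  then have O': "- ?O \<in> sets path_space"
    using sets.compl_sets[OF O] by (simp add: Compl_eq_Diff_UNIV)
  have m: "(\<lambda>x. emeasure (chain_law P x) (- ?O)) \<in> borel_measurable \<mu>"
    using emeasure_chain_law_measurable[OF tk O'] by (simp add: measurable_cong_sets[OF sets_mu refl])
  have "emeasure (chain_law_from P \<mu>) (- ?O) = 0"
    using osc AE_iff_measurable[of "- ?O" "chain_law_from P \<mu>" "\<lambda>\<omega>. \<omega> \<in> ?O"] O' by (auto simp: Compl_eq)
  then have "AE x in \<mu>. emeasure (chain_law P x) (- ?O) = 0"
    unfolding emeasure_chain_law_from_borel[OF tk sets_mu O'] nn_integral_0_iff_AE[OF m] .
  then show ?thesis
  proof eventually_elim
    case (elim x)
    interpret prob_space "chain_law P x" by (rule prob_space_chain_law[OF tk])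
    have "emeasure (chain_law P x) ?O + emeasure (chain_law P x) (- ?O) = emeasure (chain_law P x) (?O \<union> - ?O)"
      by (rule plus_emeasure) (use O O' in \<open>auto simp: sets_chain_law[OF tk]\<close>)
    with elim emeasure_space_1 show ?case
      by (simp add: recurrent_states_def space_chain_law[OF tk] del: Un_insert_left)
  qed
qed

lemma distr_chain_law_1:
  assumes tk: "transition_kernel P"
  shows "distr (chain_law P x) borel (\<lambda>\<omega>. \<omega> 1) = P x"
proof (rule measure_eqI)
  fix B :: "'a set" assume "B \<in> sets (distr (chain_law P x) borel (\<lambda>\<omega>. \<omega> 1))"
  then have B: "B \<in> sets borel" by simp
  have m: "(\<lambda>\<omega>. \<omega> 1) \<in> chain_law P x \<rightarrow>\<^sub>M borel"
    by (simp add: measurable_cong_sets[OF sets_chain_law[OF tk] refl])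
  show "emeasure (distr (chain_law P x) borel (\<lambda>\<omega>. \<omega> 1)) B = emeasure (P x) B"
    unfolding emeasure_distr[OF m B] emeasure_chain_law_1[OF tk B, symmetric]
    by (simp add: space_chain_law[OF tk] vimage_def)
qed (simp add: transition_kernelD(3)[OF tk])

lemma entr_kernel_Some_image:
  assumes tk: "transition_kernel P" and A: "A \<in> sets borel" and B: "B \<in> sets borel" "B \<subseteq> A"
  shows "emeasure (entr_kernel P A (Some x)) (Some ` B) = emeasure (chain_law P x) {\<omega>. entr_chain A 1 \<omega> \<in> Some ` B}"
proof -
  have "Some ` B \<in> sets (cemetery_space A)"
    using B by (auto simp: sets_cemetery_space[OF A] inj_vimage_image_eq)
  moreover have "entr_chain A 1 \<in> chain_law P x \<rightarrow>\<^sub>M cemetery_space A"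
    using measurable_entr_chain[OF A] by (simp add: measurable_cong_sets[OF sets_chain_law[OF tk] refl])
  ultimately show ?thesis
    unfolding entr_kernel_def by (simp add: emeasure_distr space_chain_law[OF tk] vimage_def del: One_nat_def)
qed

lemma entr_chain_sets:
  fixes A :: "'a::topological_space set"
  assumes A: "A \<in> sets borel" and B: "B \<in> sets borel" "B \<subseteq> A"
  shows "{\<omega>. entr_chain A 1 \<omega> \<in> Some ` B} \<in> sets path_space"
proof -
  have "Some ` B \<in> sets (cemetery_space A)"
    using B by (auto simp: sets_cemetery_space[OF A] inj_vimage_image_eq)
  from measurable_sets[OF measurable_entr_chain[OF A] this] show ?thesis
    by (simp add: vimage_def del: One_nat_def)
qed

lemma Some_image_sets_cemetery:
  assumes A: "A \<in> sets borel" and B: "B \<in> sets borel" "B \<subseteq> - A"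
  shows "Some ` B \<in> sets (cemetery_space (- A))"
proof -
  have "- A \<in> sets borel" using A by measurable
  then show ?thesis
    using B by (auto simp: sets_cemetery_space inj_vimage_image_eq)
qed

lemma exit_chain_sets:
  fixes A :: "'a::topological_space set"
  assumes A: "A \<in> sets borel" and B: "B \<in> sets borel" "B \<subseteq> - A"
  shows "{\<omega>. exit_chain A 1 \<omega> \<in> Some ` B} \<in> sets path_space"
  using measurable_sets[OF measurable_exit_chain[OF A] Some_image_sets_cemetery[OF A B]]
  by (simp add: vimage_def del: One_nat_def)

text \<open>Conditioning on the event that the first step lands in \<open>A\<close> divides by
  \<open>emeasure (P x) A\<close>. Outside \<open>exit_states\<close> the quotient is 0 / 0, which
  is 0 in \<open>ennreal\<close>, and the kernel puts all its mass on the cemetery, so a single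
  formula covers both cases.\<close>

lemma exit_kernel_Some_image:
  assumes tk: "transition_kernel P" and A[measurable]: "A \<in> sets borel" and B: "B \<in> sets borel" "B \<subseteq> - A"
    and x: "x \<notin> A"
  shows "emeasure (exit_kernel P A (Some x)) (Some ` B) =
    (\<integral>\<^sup>+z. emeasure (chain_law P z) {\<omega>. exit_chain A 1 \<omega> \<in> Some ` B} * indicator A z \<partial>P x) / emeasure (P x) A"
proof (cases "x \<in> exit_states P A")
  case False
  then have z: "emeasure (P x) A = 0"
    using x by (simp add: exit_states_def emeasure_chain_law_1[OF tk A, simplified])
  then have "(\<integral>\<^sup>+z. emeasure (chain_law P z) {\<omega>. exit_chain A 1 \<omega> \<in> Some ` B} * indicator A z \<partial>P x) = 0"
    by (intro nn_integral_null_set) (simp add: null_sets_def transition_kernelD(3)[OF tk])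
  moreover have "emeasure (exit_kernel P A (Some x)) (Some ` B) = 0"
    using False Some_image_sets_cemetery[OF A B] by (auto simp: exit_kernel_def)
  ultimately show ?thesis by (simp add: z)
next
  case True
  let ?h = "\<lambda>z. emeasure (chain_law P z) {\<omega>. exit_chain A 1 \<omega> \<in> Some ` B}"
  let ?d = "\<lambda>z. distr (chain_law P z) (cemetery_space (- A)) (exit_chain A 1)"
  note E = exit_chain_sets[OF A B]
  have h[measurable]: "?h \<in> borel_measurable borel"
    by (rule emeasure_chain_law_measurable[OF tk E])
  have sB: "Some ` B \<in> sets (cemetery_space (- A))" by (rule Some_image_sets_cemetery[OF A B])
  have A1: "{\<omega>. \<omega> 1 \<in> A} \<in> sets (chain_law P x)"
    unfolding sets_chain_law[OF tk] by (rule sets_path_spaceI) measurable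
  have m1: "(\<lambda>\<omega>. \<omega> 1) \<in> chain_law P x \<rightarrow>\<^sub>M borel"
    by (simp add: measurable_cong_sets[OF sets_chain_law[OF tk] refl])
  then have m1': "(\<lambda>\<omega>. \<omega> 1) \<in> uniform_measure (chain_law P x) {\<omega>. \<omega> 1 \<in> A} \<rightarrow>\<^sub>M borel"
    by (simp add: measurable_def)
  have dk: "?d \<in> borel \<rightarrow>\<^sub>M subprob_algebra (cemetery_space (- A))"
    by (rule measurable_compose[OF chain_law_subprob[OF tk] measurable_distr[OF measurable_exit_chain[OF A]]])
  then have dk': "?d \<in> cond_step P A x \<rightarrow>\<^sub>M subprob_algebra (cemetery_space (- A))"
    by (simp add: cond_step_def)
  have ne: "space (cond_step P A x) \<noteq> {}" by (simp add: cond_step_def)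
  have em: "emeasure (?d z) (Some ` B) = ?h z" for z
  proof -
    have "exit_chain A 1 \<in> chain_law P z \<rightarrow>\<^sub>M cemetery_space (- A)"
      using measurable_exit_chain[OF A] by (simp add: measurable_cong_sets[OF sets_chain_law[OF tk] refl])
    then show ?thesis
      using sB by (simp add: emeasure_distr space_chain_law[OF tk] vimage_def del: One_nat_def)
  qed
  have "emeasure (exit_kernel P A (Some x)) (Some ` B) = emeasure (cond_step P A x \<bind> ?d) (Some ` B)"
    using True by (simp add: exit_kernel_def)
  also have "\<dots> = (\<integral>\<^sup>+z. ?h z \<partial>cond_step P A x)"
    by (simp only: emeasure_bind[OF ne dk' sB] em)
  also have "\<dots> = (\<integral>\<^sup>+\<omega>. ?h (\<omega> 1) \<partial>uniform_measure (chain_law P x) {\<omega>. \<omega> 1 \<in> A})"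
    unfolding cond_step_def by (rule nn_integral_distr[OF m1']) (use h in simp)
  also have "\<dots> = (\<integral>\<^sup>+\<omega>. ?h (\<omega> 1) * indicator {\<omega>. \<omega> 1 \<in> A} \<omega> \<partial>chain_law P x) / emeasure (chain_law P x) {\<omega>. \<omega> 1 \<in> A}"
    by (rule nn_integral_uniform_measure[OF measurable_compose[OF m1 h] A1])
  also have "(\<integral>\<^sup>+\<omega>. ?h (\<omega> 1) * indicator {\<omega>. \<omega> 1 \<in> A} \<omega> \<partial>chain_law P x) =
      (\<integral>\<^sup>+z. ?h z * indicator A z \<partial>distr (chain_law P x) borel (\<lambda>\<omega>. \<omega> 1))"
  proof (subst nn_integral_distr[OF m1])
    have "(\<lambda>z. ?h z * indicator A z) \<in> borel_measurable borel" by measurable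
    then show "(\<lambda>z. ?h z * indicator A z) \<in> borel_measurable (distr (chain_law P x) borel (\<lambda>\<omega>. \<omega> 1))"
      by (simp only: measurable_distr_eq1)
  qed (auto intro!: nn_integral_cong split: split_indicator)
  finally show ?thesis
    by (simp only: distr_chain_law_1[OF tk] emeasure_chain_law_1[OF tk A])
qed

context dual_chains
begin

text \<open>Adjointness with \<open>f = indicator (- A)\<close> and \<open>g = indicator B\<close>:
  entering \<open>B\<close> from outside \<open>A\<close> is, for the dual chain, leaving
  \<open>A\<close> from \<open>B\<close>.\<close>

lemma mu_entr_eq_density:
  assumes A[measurable]: "A \<in> sets borel"
  shows "mu_entr P \<mu> A = density (restrict_space \<mu> A) (\<lambda>x. emeasure (P' x) (- A))"
proof (rule measure_eqI)
  have s: "sets (restrict_space \<mu> A) = sets (restrict_space borel A)"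
    by (rule sets_restrict_space_cong[OF sets_mu])
  show "sets (mu_entr P \<mu> A) = sets (density (restrict_space \<mu> A) (\<lambda>x. emeasure (P' x) (- A)))"
    by (simp add: sets_mu_entr[OF tk sets_mu A] s)
  fix B assume "B \<in> sets (mu_entr P \<mu> A)"
  then have B': "B \<in> sets (restrict_space borel A)" by (simp add: sets_mu_entr[OF tk sets_mu A])
  then have B[measurable]: "B \<in> sets borel" and BA: "B \<subseteq> A" by (auto simp: sets_restrict_space_iff)
  have "- A \<in> sets borel" by measurable
  then have m: "(\<lambda>x. emeasure (P' x) (- A)) \<in> borel_measurable borel"
    by (intro measurable_compose[OF transition_kernelD(1)[OF tk'] measurable_emeasure_subprob_algebra])
  have "emeasure (mu_entr P \<mu> A) B = (\<integral>\<^sup>+x. indicator (- A) x * (\<integral>\<^sup>+y. indicator B y \<partial>P x) \<partial>\<mu>)"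
    by (simp add: emeasure_mu_entr[OF tk sets_mu A B BA] transition_kernelD(3)[OF tk])
  also have "\<dots> = (\<integral>\<^sup>+y. indicator B y * (\<integral>\<^sup>+x. indicator (- A) x \<partial>P' y) \<partial>\<mu>)"
    by (rule dual_kernels_nn_integral[OF tk tk' sets_mu dual]) measurable
  also have "\<dots> = (\<integral>\<^sup>+x. (emeasure (P' x) (- A) * indicator B x) * indicator A x \<partial>\<mu>)"
    using BA by (auto intro!: nn_integral_cong simp: transition_kernelD(3)[OF tk'] split: split_indicator)
  also have "\<dots> = (\<integral>\<^sup>+x. emeasure (P' x) (- A) * indicator B x \<partial>restrict_space \<mu> A)"
    by (subst nn_integral_restrict_space) (auto simp: sets_mu)
  also have "\<dots> = emeasure (density (restrict_space \<mu> A) (\<lambda>x. emeasure (P' x) (- A))) B"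
    using B' by (intro emeasure_density[symmetric] borel_measurable_restrict[OF s m]) (simp add: s)
  finally show "emeasure (mu_entr P \<mu> A) B = emeasure (density (restrict_space \<mu> A) (\<lambda>x. emeasure (P' x) (- A))) B" .
qed

lemma invariant_measure_dual: "invariant_measure (\<lambda>x B. emeasure (P' x) B) \<mu>"
  unfolding invariant_measure_def
proof
  fix B assume "B \<in> sets \<mu>"
  then have B[measurable]: "B \<in> sets borel" by (simp add: sets_mu)
  have "(\<integral>\<^sup>+x. indicator B x * (\<integral>\<^sup>+y. 1 \<partial>P x) \<partial>\<mu>) = (\<integral>\<^sup>+y. 1 * (\<integral>\<^sup>+x. indicator B x \<partial>P' y) \<partial>\<mu>)"
    by (rule dual_kernels_nn_integral[OF tk tk' sets_mu dual]) measurable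
  then show "(\<integral>\<^sup>+x. emeasure (P' x) B \<partial>\<mu>) = emeasure \<mu> B"
    using prob_space.emeasure_space_1[OF transition_kernelD(2)[OF tk]]
    by (simp add: transition_kernelD(3)[OF tk'] sets_mu)
qed

text \<open>By its density the entrance measure is absolutely continuous with respect to \<mu>, so
  \<mu>-null sets of non-recurrent states stay null.\<close>

lemma proper_entr_mu_entr:
  assumes A[measurable]: "A \<in> sets borel" and R: "AE x in \<mu>. x \<in> recurrent_states P A"
  shows "proper_entr P A (mu_entr P \<mu> A)"
proof -
  have s: "sets (restrict_space \<mu> A) = sets (restrict_space borel A)"
    by (rule sets_restrict_space_cong[OF sets_mu])
  have "- A \<in> sets borel" by measurable
  then have m: "(\<lambda>x. emeasure (P' x) (- A)) \<in> borel_measurable borel"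
    by (intro measurable_compose[OF transition_kernelD(1)[OF tk'] measurable_emeasure_subprob_algebra])
  have [measurable]: "recurrent_states P A \<in> sets borel" by (rule recurrent_states_sets[OF tk A])
  have "AE x in restrict_space \<mu> A. x \<in> A - recurrent_states P A \<longrightarrow> emeasure (P' x) (- A) = 0"
    using R by (subst AE_restrict_space_iff) (auto simp: sets_mu elim: eventually_mono)
  then show ?thesis
    unfolding proper_entr_def mu_entr_eq_density[OF A] null_sets_density_iff[OF borel_measurable_restrict[OF s m]]
    by (auto simp: s sets_restrict_space_iff)
qed

lemma mu_exit_eq:
  assumes A: "A \<in> sets borel"
  shows "mu_exit P \<mu> A = density (restrict_space \<mu> (- A)) (\<lambda>x. emeasure (P x) A)"
  unfolding mu_exit_def emeasure_chain_law_1[OF tk A] ..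

text \<open>In \<open>- A\<close>, a state outside \<open>exit_states\<close> has density 0, and the
  non-recurrent states are already \<mu>-null.\<close>

lemma proper_exit_mu_exit:
  assumes A[measurable]: "A \<in> sets borel" and R: "AE x in \<mu>. x \<in> recurrent_states P A"
  shows "proper_exit P A (mu_exit P \<mu> A)"
proof -
  have s: "sets (restrict_space \<mu> (- A)) = sets (restrict_space borel (- A))"
    by (rule sets_restrict_space_cong[OF sets_mu])
  have m[measurable]: "(\<lambda>x. emeasure (P x) A) \<in> borel_measurable borel"
    by (intro measurable_compose[OF transition_kernelD(1)[OF tk] measurable_emeasure_subprob_algebra] A)
  have [measurable]: "recurrent_states P A \<in> sets borel" by (rule recurrent_states_sets[OF tk A])
  have ex: "exit_states P A = {x \<in> - A. emeasure (P x) A > 0}"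
    unfolding exit_states_def emeasure_chain_law_1[OF tk A] ..
  have "{x \<in> space borel. x \<in> - A \<and> emeasure (P x) A > 0} \<in> sets borel" by measurable
  then have [measurable]: "exit_states P A \<in> sets borel" by (simp add: ex)
  have "AE x in restrict_space \<mu> (- A). x \<in> - A - (exit_states P A \<inter> recurrent_states P A) \<longrightarrow> emeasure (P x) A = 0"
    using R by (subst AE_restrict_space_iff) (auto simp: sets_mu ex elim: eventually_mono)
  then show ?thesis
    unfolding proper_exit_def mu_exit_eq[OF A] null_sets_density_iff[OF borel_measurable_restrict[OF s m]]
    by (auto simp: s sets_restrict_space_iff)
qed

text \<open>Once \<open>G\<close> is cut down to \<open>(- A) \<times> A\<close>, the marked pair is
  itself a crossing, hence the first one after step 0. The forward events are then disjoint, and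
  their sum is the measure of one event about the next crossing.\<close>

lemma first_crossing_transport:
  assumes A[measurable]: "A \<in> sets borel" and G[measurable]: "G \<in> sets (borel \<Otimes>\<^sub>M borel)"
    and osc: "AE \<omega> in chain_law_from P' \<mu>. (\<exists>\<^sub>\<infinity>k. \<omega> k \<in> A) \<and> (\<exists>\<^sub>\<infinity>k. \<omega> k \<in> - A)"
  shows "emeasure (chain_law_from P \<mu>) {\<omega>. crossing A \<omega> 0 \<and>
      (\<exists>n. crossing A \<omega> (Suc n) \<and> (\<forall>i<n. \<not> crossing A \<omega> (Suc i)) \<and> (\<omega> (Suc n), \<omega> (Suc (Suc n))) \<in> G)} =
    emeasure (chain_law_from P \<mu>) {\<omega>. crossing A \<omega> 0 \<and> (\<omega> 0, \<omega> 1) \<in> G}"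
proof -
  let ?G = "G \<inter> ((- A) \<times> A)"
  have G': "?G \<in> sets (borel \<Otimes>\<^sub>M borel)" by measurable
  then have [measurable]: "Measurable.pred path_space (\<lambda>\<omega> :: nat \<Rightarrow> 'a. (\<omega> a, \<omega> b) \<in> ?G)" for a b
    by measurable
  let ?E = "\<lambda>n. {\<omega>. crossing A \<omega> 0 \<and> (\<forall>i<n. \<not> crossing A \<omega> (Suc i)) \<and> (\<omega> (Suc n), \<omega> (Suc (Suc n))) \<in> ?G}"
  have E: "?E n \<in> sets path_space" for n
    by (rule sets_path_spaceI) measurable
  have c: "(\<omega> i, \<omega> (Suc i)) \<in> ?G \<longleftrightarrow> crossing A \<omega> i \<and> (\<omega> i, \<omega> (Suc i)) \<in> G" for \<omega> i
    by (auto simp: crossing_def)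
  have "{\<omega>. crossing A \<omega> 0 \<and>
      (\<exists>n. crossing A \<omega> (Suc n) \<and> (\<forall>i<n. \<not> crossing A \<omega> (Suc i)) \<and> (\<omega> (Suc n), \<omega> (Suc (Suc n))) \<in> G)} = (\<Union>n. ?E n)"
    unfolding c by blast
  moreover have "(\<Sum>n. emeasure (chain_law_from P \<mu>) (?E n)) = emeasure (chain_law_from P \<mu>) (\<Union>n. ?E n)"
  proof (rule suminf_emeasure)
    have le: "n \<le> m" if "\<omega> \<in> ?E n" "\<omega> \<in> ?E m" for \<omega> n m
    proof (rule ccontr)
      assume "\<not> n \<le> m"
      then have "m < n" by simp
      moreover have "crossing A \<omega> (Suc m)" using that(2) unfolding c by simp
      ultimately show False using that(1) by simp
    qed
    show "disjoint_family ?E"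
      unfolding disjoint_family_on_def
    proof (intro ballI impI)
      fix m n :: nat assume "m \<noteq> n"
      have False if "\<omega> \<in> ?E m" "\<omega> \<in> ?E n" for \<omega>
        using le[OF that] le[OF that(2,1)] \<open>m \<noteq> n\<close> by simp
      then show "?E m \<inter> ?E n = {}" by blast
    qed
  qed (use E in auto)
  moreover have "{\<omega>. (\<omega> 0, \<omega> 1) \<in> ?G} = {\<omega>. crossing A \<omega> 0 \<and> (\<omega> 0, \<omega> 1) \<in> G}"
    using c[of _ 0] by simp
  ultimately show ?thesis
    using crossing_transport[OF A G' osc] by (simp only:)
qed

lemma crossing_shift: "crossing A (\<lambda>n. \<omega> (Suc n)) i \<longleftrightarrow> crossing A \<omega> (Suc i)"
  by (simp add: crossing_def)

lemma invariant_entr_mu_entr: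
  assumes A[measurable]: "A \<in> sets borel"
    and osc: "AE \<omega> in chain_law_from P' \<mu>. (\<exists>\<^sub>\<infinity>k. \<omega> k \<in> A) \<and> (\<exists>\<^sub>\<infinity>k. \<omega> k \<in> - A)"
  shows "invariant_entr P A (mu_entr P \<mu> A)"
  unfolding invariant_entr_def invariant_measure_def
proof
  fix B assume "B \<in> sets (mu_entr P \<mu> A)"
  then have B[measurable]: "B \<in> sets borel" and BA: "B \<subseteq> A"
    by (auto simp: sets_mu_entr[OF tk sets_mu A] sets_restrict_space_iff)
  let ?E = "{\<omega>. entr_chain A 1 \<omega> \<in> Some ` B}"
  have E: "?E \<in> sets path_space" by (rule entr_chain_sets[OF A B BA])
  \<comment> \<open>Only the state entered at the marked crossing is tested.\<close>
  have G: "UNIV \<times> B \<in> sets (borel \<Otimes>\<^sub>M borel :: ('a \<times> 'a) measure)" by measurable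
  have "(\<integral>\<^sup>+x. emeasure (entr_kernel P A (Some x)) (Some ` B) \<partial>mu_entr P \<mu> A) =
      emeasure (chain_law_from P (mu_entr P \<mu> A)) ?E"
    unfolding entr_kernel_Some_image[OF tk A B BA]
    by (rule emeasure_chain_law_from[OF tk sets_mu_entr[OF tk sets_mu A] E, symmetric])
  also have "\<dots> = emeasure (chain_law_from P \<mu>) {\<omega>. crossing A \<omega> 0 \<and> (\<lambda>n. \<omega> (Suc n)) \<in> ?E}"
    by (rule emeasure_chain_law_from_mu_entr[OF tk sets_mu A E])
  also have "{\<omega>. crossing A \<omega> 0 \<and> (\<lambda>n. \<omega> (Suc n)) \<in> ?E} = {\<omega>. crossing A \<omega> 0 \<and>
      (\<exists>n. crossing A \<omega> (Suc n) \<and> (\<forall>i<n. \<not> crossing A \<omega> (Suc i)) \<and> (\<omega> (Suc n), \<omega> (Suc (Suc n))) \<in> UNIV \<times> B)}"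
    unfolding mem_Collect_eq entr_chain_in_iff crossing_shift by (simp add: image_iff)
  also have "emeasure (chain_law_from P \<mu>) \<dots> = emeasure (chain_law_from P \<mu>) {\<omega>. crossing A \<omega> 0 \<and> (\<omega> 0, \<omega> 1) \<in> UNIV \<times> B}"
    by (rule first_crossing_transport[OF A G osc])
  also have "{\<omega>. crossing A \<omega> 0 \<and> (\<omega> 0, \<omega> 1) \<in> UNIV \<times> B} = {\<omega>. \<omega> 0 \<in> - A \<and> \<omega> 1 \<in> B}"
    using BA by (intro Collect_cong) (auto simp: crossing_def)
  also have "emeasure (chain_law_from P \<mu>) \<dots> = emeasure (mu_entr P \<mu> A) B"
    unfolding emeasure_mu_entr[OF tk sets_mu A B BA]
    by (rule emeasure_path_measure_01[OF tk sets_mu _ B]) measurable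
  finally show "(\<integral>\<^sup>+x. emeasure (entr_kernel P A (Some x)) (Some ` B) \<partial>mu_entr P \<mu> A) = emeasure (mu_entr P \<mu> A) B" .
qed

text \<open>The density P(x,A) of the exit measure cancels the conditioning in the exit kernel. What
  remains is the integral over \<open>mu_entr\<close> of the probability that the next exit position
  lies in \<open>B\<close>.\<close>

lemma invariant_exit_mu_exit:
  assumes A[measurable]: "A \<in> sets borel"
    and osc: "AE \<omega> in chain_law_from P' \<mu>. (\<exists>\<^sub>\<infinity>k. \<omega> k \<in> A) \<and> (\<exists>\<^sub>\<infinity>k. \<omega> k \<in> - A)"
  shows "invariant_exit P A (mu_exit P \<mu> A)"
  unfolding invariant_exit_def invariant_measure_def
proof
  have s: "sets (restrict_space \<mu> (- A)) = sets (restrict_space borel (- A))"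
    by (rule sets_restrict_space_cong[OF sets_mu])
  have sp: "space (restrict_space \<mu> (- A)) = - A"
    by (simp add: space_restrict_space space_mu[OF sets_mu])
  fix B assume "B \<in> sets (mu_exit P \<mu> A)"
  then have B': "B \<in> sets (restrict_space borel (- A))"
    by (simp add: mu_exit_eq[OF A] s)
  then have B[measurable]: "B \<in> sets borel" and BA: "B \<subseteq> - A"
    by (auto simp: sets_restrict_space_iff)
  let ?E = "{\<omega>. exit_chain A 1 \<omega> \<in> Some ` B}"
  define h where "h z = emeasure (chain_law P z) ?E" for z
  define k where "k x = (\<integral>\<^sup>+z. h z * indicator A z \<partial>P x)" for x
  have E: "?E \<in> sets path_space" by (rule exit_chain_sets[OF A B BA])
  have h[measurable]: "h \<in> borel_measurable borel"
    unfolding h_def[abs_def] by (rule emeasure_chain_law_measurable[OF tk E])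
  have m[measurable]: "(\<lambda>x. emeasure (P x) A) \<in> borel_measurable borel"
    by (intro measurable_compose[OF transition_kernelD(1)[OF tk] measurable_emeasure_subprob_algebra] A)
  have [measurable]: "k \<in> borel_measurable borel"
    unfolding k_def[abs_def] by (rule nn_integral_P_measurable[OF tk]) measurable
  have G: "B \<times> UNIV \<in> sets (borel \<Otimes>\<^sub>M borel :: ('a \<times> 'a) measure)" by measurable
  \<comment> \<open>If the divisor is 0, then \<open>k x\<close> integrates over a null set and
    vanishes too; otherwise the divisor is positive and finite.\<close>
  have canc: "emeasure (P x) A * (k x / emeasure (P x) A) = k x" for x
  proof (cases "emeasure (P x) A = 0")
    case True
    then have "k x = 0"
      unfolding k_def by (intro nn_integral_null_set) (simp add: null_sets_def transition_kernelD(3)[OF tk])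
    then show ?thesis by simp
  next
    case False
    interpret prob_space "P x" by (rule transition_kernelD(2)[OF tk])
    show ?thesis
      unfolding ennreal_times_divide
      by (subst mult.commute, rule ennreal_mult_divide_eq) (use False in auto)
  qed
  have "(\<integral>\<^sup>+x. emeasure (exit_kernel P A (Some x)) (Some ` B) \<partial>mu_exit P \<mu> A) =
      (\<integral>\<^sup>+x. k x / emeasure (P x) A \<partial>mu_exit P \<mu> A)"
    unfolding k_def h_def
    by (intro nn_integral_cong exit_kernel_Some_image[OF tk A B BA]) (simp add: mu_exit_eq[OF A] sp)
  also have "\<dots> = (\<integral>\<^sup>+x. emeasure (P x) A * (k x / emeasure (P x) A) \<partial>restrict_space \<mu> (- A))"
    unfolding mu_exit_eq[OF A]
    by (intro nn_integral_density borel_measurable_restrict[OF s]) measurable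
  also have "\<dots> = (\<integral>\<^sup>+x. indicator (- A) x * k x \<partial>\<mu>)"
    unfolding canc by (subst nn_integral_restrict_space) (auto simp: sets_mu mult.commute)
  also have "\<dots> = (\<integral>\<^sup>+x. h x \<partial>mu_entr P \<mu> A)"
    unfolding k_def by (rule nn_integral_mu_entr[OF tk sets_mu A h, symmetric])
  also have "\<dots> = emeasure (chain_law_from P (mu_entr P \<mu> A)) ?E"
    unfolding h_def by (rule emeasure_chain_law_from[OF tk sets_mu_entr[OF tk sets_mu A] E, symmetric])
  also have "\<dots> = emeasure (chain_law_from P \<mu>) {\<omega>. crossing A \<omega> 0 \<and> (\<lambda>n. \<omega> (Suc n)) \<in> ?E}"
    by (rule emeasure_chain_law_from_mu_entr[OF tk sets_mu A E])
  also have "{\<omega>. crossing A \<omega> 0 \<and> (\<lambda>n. \<omega> (Suc n)) \<in> ?E} = {\<omega>. crossing A \<omega> 0 \<and>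
      (\<exists>n. crossing A \<omega> (Suc n) \<and> (\<forall>i<n. \<not> crossing A \<omega> (Suc i)) \<and> (\<omega> (Suc n), \<omega> (Suc (Suc n))) \<in> B \<times> UNIV)}"
    unfolding mem_Collect_eq exit_chain_in_iff crossing_shift by (simp add: image_iff)
  also have "emeasure (chain_law_from P \<mu>) \<dots> = emeasure (chain_law_from P \<mu>) {\<omega>. crossing A \<omega> 0 \<and> (\<omega> 0, \<omega> 1) \<in> B \<times> UNIV}"
    by (rule first_crossing_transport[OF A G osc])
  also have "{\<omega>. crossing A \<omega> 0 \<and> (\<omega> 0, \<omega> 1) \<in> B \<times> UNIV} = {\<omega>. \<omega> 0 \<in> B \<and> \<omega> 1 \<in> A}"
    using BA by (intro Collect_cong) (auto simp: crossing_def)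
  also have "emeasure (chain_law_from P \<mu>) \<dots> = (\<integral>\<^sup>+x. indicator B x * emeasure (P x) A \<partial>\<mu>)"
    by (rule emeasure_path_measure_01[OF tk sets_mu B A])
  also have "\<dots> = (\<integral>\<^sup>+x. (emeasure (P x) A * indicator B x) * indicator (- A) x \<partial>\<mu>)"
    using BA by (auto intro!: nn_integral_cong split: split_indicator)
  also have "\<dots> = (\<integral>\<^sup>+x. emeasure (P x) A * indicator B x \<partial>restrict_space \<mu> (- A))"
    by (subst nn_integral_restrict_space) (auto simp: sets_mu)
  also have "\<dots> = emeasure (mu_exit P \<mu> A) B"
    unfolding mu_exit_eq[OF A]
    using B' by (intro emeasure_density[symmetric] borel_measurable_restrict[OF s m]) (simp add: s)
  finally show "(\<integral>\<^sup>+x. emeasure (exit_kernel P A (Some x)) (Some ` B) \<partial>mu_exit P \<mu> A) = emeasure (mu_exit P \<mu> A) B" .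
qed

lemma occupation_formula:
  assumes A[measurable]: "A \<in> sets borel" and B[measurable]: "B \<in> sets borel"
    and osc: "AE \<omega> in chain_law_from P' \<mu>. (\<exists>\<^sub>\<infinity>k. \<omega> k \<in> A) \<and> (\<exists>\<^sub>\<infinity>k. \<omega> k \<in> - A)"
  shows "emeasure \<mu> B = (\<integral>\<^sup>+\<omega>. (\<Sum>k. indicator {k. enat k < entr_time A 1 \<omega>} k * indicator B (\<omega> k))
    \<partial>chain_law_from P (mu_entr P \<mu> A))"
proof -
  let ?Q = "chain_law_from P (mu_entr P \<mu> A)"
  let ?E = "\<lambda>k. {\<omega>. (\<forall>i<k. \<not> crossing A \<omega> i) \<and> \<omega> k \<in> B}"
  have E[measurable]: "?E k \<in> sets path_space" for k
    by (rule sets_path_spaceI) measurable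
  have G: "B \<times> UNIV \<in> sets (borel \<Otimes>\<^sub>M borel :: ('a \<times> 'a) measure)" by measurable
  have ind: "indicator {k. enat k < entr_time A 1 \<omega>} k * indicator B (\<omega> k) = (indicator (?E k) \<omega> :: ennreal)" for k \<omega>
    unfolding less_entr_time_1 by (auto split: split_indicator)
  have "(\<integral>\<^sup>+\<omega>. (\<Sum>k. indicator {k. enat k < entr_time A 1 \<omega>} k * indicator B (\<omega> k)) \<partial>?Q) =
      (\<Sum>k. emeasure ?Q (?E k))"
    unfolding ind by (subst nn_integral_suminf) (use E in auto)
  also have "\<dots> = (\<Sum>k. emeasure (chain_law_from P \<mu>)
      {\<omega>. crossing A \<omega> 0 \<and> (\<forall>i<k. \<not> crossing A \<omega> (Suc i)) \<and> (\<omega> (Suc k), \<omega> (Suc (Suc k))) \<in> B \<times> UNIV})"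
    unfolding emeasure_chain_law_from_mu_entr[OF tk sets_mu A E]
    by (simp add: crossing_def)
  also have "\<dots> = emeasure (chain_law_from P \<mu>) {\<omega>. (\<omega> 0, \<omega> 1) \<in> B \<times> UNIV}"
    by (rule crossing_transport[OF A G osc])
  also have "\<dots> = emeasure \<mu> B"
    using emeasure_path_measure_0[OF tk sets_mu B] by simp
  finally show ?thesis by simp
qed

end

section \<open>Existence of the dual kernel\<close>

abbreviation digit_space :: "(nat \<Rightarrow> nat) measure" where
  "digit_space \<equiv> PiM UNIV (\<lambda>_. count_space UNIV)"

definition prefix_set :: "nat list \<Rightarrow> (nat \<Rightarrow> nat) set" where
  "prefix_set s = {\<omega>. \<forall>i<length s. \<omega> i = s ! i}"

text \<open>Kolmogorov consistency of the masses of prefix sets. The conditions are countably many,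
  so they hold simultaneously almost everywhere once each does.\<close>

definition prefix_weights :: "(nat list \<Rightarrow> ennreal) \<Rightarrow> bool" where
  "prefix_weights w \<longleftrightarrow> w [] = 1 \<and> (\<forall>s. (\<Sum>j. w (s @ [j])) = w s)"

lemma space_digit_space[simp]: "space digit_space = UNIV"
  by (simp add: space_PiM)

lemma prefix_set_Nil[simp]: "prefix_set [] = UNIV"
  by (simp add: prefix_set_def)

lemma prefix_set_snoc: "\<omega> \<in> prefix_set (s @ [j]) \<longleftrightarrow> \<omega> \<in> prefix_set s \<and> \<omega> (length s) = j"
  by (auto simp: prefix_set_def nth_append less_Suc_eq)

lemma sets_prefix_set[measurable]: "prefix_set s \<in> sets digit_space"
proof -
  have "{\<omega> \<in> space digit_space. \<forall>i<length s. \<omega> i = s ! i} \<in> sets digit_space"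
    by measurable
  then show ?thesis by (simp add: prefix_set_def)
qed

lemma map_upt_prefix_set: "\<omega> \<in> prefix_set s \<Longrightarrow> map \<omega> [0..<length s] = s"
  by (rule nth_equalityI) (auto simp: prefix_set_def)

lemma sets_digit_space: "sets digit_space = sigma_sets UNIV (insert {} (range prefix_set))"
proof (rule antisym)
  have "{f \<in> space digit_space. f i \<in> A} \<in> sigma_sets UNIV (insert {} (range prefix_set))" for i A
  proof -
    \<comment> \<open>A constraint on digit \<open>i\<close> is the union over the countably many
      prefixes of length \<open>Suc i\<close> that satisfy it.\<close>
    let ?S = "{s. length s = Suc i \<and> s ! i \<in> A}"
    have "{f \<in> space digit_space. f i \<in> A} = \<Union>(prefix_set ` ?S)"
    proof (intro set_eqI iffI)
      fix f assume "f \<in> {f \<in> space digit_space. f i \<in> A}"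
      then have "map f [0..<Suc i] \<in> ?S" "f \<in> prefix_set (map f [0..<Suc i])"
        by (auto simp: prefix_set_def simp del: upt_Suc)
      then show "f \<in> \<Union>(prefix_set ` ?S)" by blast
    qed (auto simp: prefix_set_def)
    also have "\<dots> \<in> sigma_sets UNIV (insert {} (range prefix_set))"
      by (rule sigma_sets_UNION) auto
    finally show ?thesis .
  qed
  then show "sets digit_space \<subseteq> sigma_sets UNIV (insert {} (range prefix_set))"
    unfolding sets_PiM_single space_PiM[symmetric]
    by (simp only: space_digit_space) (intro sigma_sets_mono, auto)
  show "sigma_sets UNIV (insert {} (range prefix_set)) \<subseteq> sets digit_space"
  proof -
    have "insert {} (range prefix_set) \<subseteq> sets digit_space"
      by (intro insert_subsetI image_subsetI sets_prefix_set sets.empty_sets)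
    then show ?thesis
      using sets.sigma_sets_subset[of "insert {} (range prefix_set)" digit_space] by simp
  qed
qed

text \<open>Two prefix sets are nested or disjoint; the disjoint case is why the empty set belongs
  to the generator.\<close>

lemma Int_stable_prefix_sets: "Int_stable (insert {} (range prefix_set))"
proof -
  have *: "prefix_set s \<inter> prefix_set t \<in> insert {} (range prefix_set)" if "length s \<le> length t" for s t
  proof (cases "\<forall>i<length s. s ! i = t ! i")
    case True
    then have "prefix_set s \<inter> prefix_set t = prefix_set t"
      using that by (auto simp: prefix_set_def)
    then show ?thesis by simp
  next
    case False
    then obtain i where "i < length s" "s ! i \<noteq> t ! i" by blast
    then have "prefix_set s \<inter> prefix_set t = {}"
      using that by (auto simp: prefix_set_def)
    then show ?thesis by simp
  qed
  have "prefix_set s \<inter> prefix_set t \<in> insert {} (range prefix_set)" for s t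
    using *[of s t] *[of t s] by (cases "length s \<le> length t") (auto simp: Int_commute)
  then show ?thesis
    by (intro Int_stableI) auto
qed

text \<open>The digits are drawn one at a time, each from the weights conditioned on the prefix drawn
  so far.\<close>

lemma prefix_weights_measure:
  assumes w: "prefix_weights w"
  shows "\<exists>Q. prob_space Q \<and> sets Q = sets digit_space \<and> (\<forall>s. emeasure Q (prefix_set s) = w s)"
proof -
  have w0: "w [] = 1" and ws: "(\<Sum>j. w (s @ [j])) = w s" for s
    using w by (auto simp: prefix_weights_def)
  have w_le: "w (s @ [j]) \<le> w s" for s j
    using sum_le_suminf[of "\<lambda>j. w (s @ [j])" "{j}"] ws[of s] by simp
  have w1: "w s \<le> 1" for s
    by (induction s rule: rev_induct) (auto simp: w0 intro: order_trans[OF w_le])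
  have fin: "w s \<noteq> \<top>" for s
    using w1[of s] by (auto simp: top_unique)
  \<comment> \<open>A prefix of weight 0 leaves nothing to condition on, and the next digit is then
    0 by default.\<close>
  define K :: "nat list \<Rightarrow> nat measure" where
    "K s = (if w s = 0 then return (count_space UNIV) 0
      else density (count_space UNIV) (\<lambda>j. w (s @ [j]) / w s))" for s
  have sK: "sets (K s) = sets (count_space UNIV)" for s
    by (simp add: K_def)
  have pK: "prob_space (K s)" for s
  proof (cases "w s = 0")
    case False
    have "emeasure (K s) (space (K s)) = (\<Sum>j. w (s @ [j]) / w s)"
      using False by (simp add: K_def emeasure_density nn_integral_count_space_nat)
    also have "\<dots> = 1"
      using False fin[of s] ennreal_mult_divide_eq[of "w s" 1]
      by (simp add: divide_ennreal_def ennreal_suminf_multc ws)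
    finally show ?thesis by (rule prob_spaceI)
  qed (simp add: K_def prob_space_return)
  have IT: "Ionescu_Tulcea (\<lambda>n \<omega>. K (map \<omega> [0..<n])) (\<lambda>_. count_space UNIV)"
  proof (rule Ionescu_Tulcea.intro)
    fix i :: nat
    \<comment> \<open>Finitely many digits form a discrete space, on which measurability is
      automatic.\<close>
    have "PiM {0..<i} (\<lambda>_. count_space UNIV :: nat measure) = count_space (PiE {0..<i} (\<lambda>_. UNIV))"
      by (rule count_space_PiM_finite) auto
    then show "(\<lambda>\<omega>. K (map \<omega> [0..<i])) \<in> PiM {0..<i} (\<lambda>_. count_space UNIV) \<rightarrow>\<^sub>M subprob_algebra (count_space UNIV)"
      by (simp add: space_subprob_algebra sK pK prob_space_imp_subprob_space)
  qed (rule pK)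
  interpret Ionescu_Tulcea "\<lambda>n \<omega>. K (map \<omega> [0..<n])" "\<lambda>_. count_space UNIV"
    by (rule IT)
  have ml: "sets PF.lim = sets digit_space" by simp
  have one: "emeasure PF.lim UNIV = 1"
    using prob_space.emeasure_space_1[OF prob_space_lim] by simp
  have "emeasure PF.lim (prefix_set s) = w s" for s
  proof (induction s rule: rev_induct)
    case (snoc j s)
    let ?n = "length s"
    let ?F = "\<lambda>\<omega>. indicator (prefix_set (s @ [j])) \<omega> :: ennreal"
    have F: "?F \<in> borel_measurable (PiM {0..<Suc ?n} (\<lambda>_. count_space UNIV))"
    proof -
      have "PiM {0..<Suc ?n} (\<lambda>_. count_space UNIV :: nat measure) = count_space (PiE {0..<Suc ?n} (\<lambda>_. UNIV))"
        by (rule count_space_PiM_finite) auto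
      then show ?thesis by simp
    qed
    \<comment> \<open>Where the default digit was used, \<open>w s = 0\<close> forces the weight of
      every extension to be 0, so the default leaves no trace in the masses.\<close>
    have step: "w (s @ [j]) = emeasure (K s) {j} * w s"
    proof (cases "w s = 0")
      case True
      then show ?thesis using w_le[of s j] by simp
    next
      case False
      then have "emeasure (K s) {j} = w (s @ [j]) / w s"
        by (simp add: K_def emeasure_density nn_integral_indicator_singleton)
      then show ?thesis using False fin[of s] ennreal_mult_divide_eq[of "w s" 1]
        by (simp add: ennreal_divide_times)
    qed
    have "emeasure PF.lim (prefix_set (s @ [j])) = (\<integral>\<^sup>+\<omega>. ?F \<omega> \<partial>PF.lim)"
      using sets_prefix_set[of "s @ [j]"] by simp
    also have "\<dots> = (\<integral>\<^sup>+\<omega>. ?F (restrict \<omega> {0..<Suc ?n}) \<partial>PF.lim)"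
      by (intro nn_integral_cong) (auto simp: prefix_set_def split: split_indicator)
    also have "\<dots> = (\<integral>\<^sup>+\<omega>. (\<integral>\<^sup>+y. ?F ((restrict \<omega> {0..<?n})(?n := y)) \<partial>K (map (restrict \<omega> {0..<?n}) [0..<?n])) \<partial>PF.lim)"
      by (rule nn_integral_lim_Suc[OF F])
    also have "\<dots> = (\<integral>\<^sup>+\<omega>. emeasure (K s) {j} * indicator (prefix_set s) \<omega> \<partial>PF.lim)"
    proof (intro nn_integral_cong)
      fix \<omega> :: "nat \<Rightarrow> nat"
      let ?\<omega> = "restrict \<omega> {0..<?n}"
      have F': "?F (?\<omega>(?n := y)) = indicator (prefix_set s) \<omega> * indicator {j} y" for y
        by (auto simp: prefix_set_snoc split: split_indicator) (auto simp: prefix_set_def)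
      have K': "K (map ?\<omega> [0..<?n]) = K s" if "\<omega> \<in> prefix_set s"
      proof -
        have "map ?\<omega> [0..<?n] = map \<omega> [0..<?n]" by simp
        then show ?thesis using map_upt_prefix_set[OF that] by simp
      qed
      show "(\<integral>\<^sup>+y. ?F (?\<omega>(?n := y)) \<partial>K (map ?\<omega> [0..<?n])) = emeasure (K s) {j} * indicator (prefix_set s) \<omega>"
        unfolding F' by (cases "\<omega> \<in> prefix_set s") (simp_all add: K' sK)
    qed
    also have "\<dots> = emeasure (K s) {j} * emeasure PF.lim (prefix_set s)"
      using sets_prefix_set[of s] by (intro nn_integral_cmult_indicator) simp
    finally show ?case using step snoc by simp
  qed (simp add: one w0)
  then show ?thesis using ml prob_space_lim by blast
qed

text \<open>A point of a Polish space is coded by the indices of approximations from a dense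
  sequence and recovered as their limit, so a kernel on digit sequences can be pushed forward
  to the space without knowing that the set of codes is measurable.\<close>

lemma polish_coding:
  obtains \<phi> :: "'a::polish_space \<Rightarrow> nat \<Rightarrow> nat" and \<psi> :: "(nat \<Rightarrow> nat) \<Rightarrow> 'a"
  where "\<phi> \<in> borel \<rightarrow>\<^sub>M digit_space" "\<psi> \<in> digit_space \<rightarrow>\<^sub>M borel" "\<And>x. \<psi> (\<phi> x) = x"
proof -
  obtain D :: "'a set" where D: "countable D" "\<And>X. open X \<Longrightarrow> X \<noteq> {} \<Longrightarrow> \<exists>d\<in>D. d \<in> X"
    by (rule countable_dense_setE) blast
  have "D \<noteq> {}" using D(2)[of UNIV] by auto
  define d where "d = from_nat_into D"
  have rd: "range d = D"
    unfolding d_def by (rule range_from_nat_into[OF \<open>D \<noteq> {}\<close> D(1)])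
  have ex: "\<exists>i. dist x (d i) < (1/2)^k" for x k
  proof -
    have "x \<in> ball x ((1/2)^k)" by simp
    then have "ball x ((1/2)^k) \<noteq> {}" by blast
    then have "\<exists>y\<in>D. y \<in> ball x ((1/2)^k)" by (rule D(2)[OF open_ball])
    then have "\<exists>i. d i \<in> ball x ((1/2)^k)"
      unfolding rd[symmetric] by simp
    then show ?thesis by simp
  qed
  \<comment> \<open>Taking the least admissible index makes the choice measurable in
    \<open>x\<close>.\<close>
  define \<phi> where "\<phi> x k = (LEAST i. dist x (d i) < (1/2)^k)" for x k
  have \<phi>: "dist x (d (\<phi> x k)) < (1/2)^k" for x k
    unfolding \<phi>_def by (rule LeastI_ex[OF ex])
  \<comment> \<open>On sequences that do not give Cauchy approximations a constant is used, so the
    limit exists everywhere and decoding is a pointwise limit of measurable maps.\<close>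
  define g where "g \<omega> k = (if Cauchy (\<lambda>k. d (\<omega> k)) then d (\<omega> k) else d 0)" for \<omega> and k :: nat
  define \<psi> where "\<psi> \<omega> = lim (g \<omega>)" for \<omega>
  have dm[measurable]: "(\<lambda>\<omega>. d (\<omega> k)) \<in> borel_measurable digit_space" for k
    by (rule measurable_compose[OF measurable_component_singleton]) auto
  have [measurable]: "{\<omega> \<in> space digit_space. Cauchy (\<lambda>k. d (\<omega> k))} \<in> sets digit_space"
    by measurable
  have gm: "(\<lambda>\<omega>. g \<omega> k) \<in> borel_measurable digit_space" for k
    unfolding g_def by measurable
  have conv: "g \<omega> \<longlonglongrightarrow> \<psi> \<omega>" for \<omega>
  proof -
    have "convergent (g \<omega>)"
    proof (cases "Cauchy (\<lambda>k. d (\<omega> k))")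
      case True
      then have "g \<omega> = (\<lambda>k. d (\<omega> k))" by (simp add: g_def fun_eq_iff)
      then show ?thesis using Cauchy_convergent[OF True] by simp
    next
      case False
      then have "g \<omega> = (\<lambda>_. d 0)" by (simp add: g_def fun_eq_iff)
      then show ?thesis by (simp add: convergent_const)
    qed
    then show ?thesis
      unfolding \<psi>_def by (simp add: convergent_LIMSEQ_iff)
  qed
  have \<psi>: "\<psi> \<in> digit_space \<rightarrow>\<^sub>M borel"
    by (rule borel_measurable_LIMSEQ_metric[where f="\<lambda>k \<omega>. g \<omega> k", OF gm conv])
  have \<phi>m: "\<phi> \<in> borel \<rightarrow>\<^sub>M digit_space"
  proof (rule measurable_PiM_single')
    show "(\<lambda>x. \<phi> x k) \<in> borel \<rightarrow>\<^sub>M count_space UNIV" for k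
      unfolding \<phi>_def by measurable
  qed simp
  have "\<psi> (\<phi> x) = x" for x
  proof -
    have "(\<lambda>k. dist (d (\<phi> x k)) x) \<longlonglongrightarrow> 0"
    proof (rule tendsto_sandwich[where f="\<lambda>_. 0" and h="\<lambda>k. (1/2)^k"])
      show "(\<lambda>k. (1/2 :: real)^k) \<longlonglongrightarrow> 0" by (rule LIMSEQ_realpow_zero) auto
      show "\<forall>\<^sub>F k in sequentially. dist (d (\<phi> x k)) x \<le> (1/2)^k"
        using \<phi>[of x] by (intro always_eventually allI) (simp add: dist_commute less_imp_le)
      show "\<forall>\<^sub>F k in sequentially. 0 \<le> dist (d (\<phi> x k)) x" by simp
    qed simp
    then have l: "(\<lambda>k. d (\<phi> x k)) \<longlonglongrightarrow> x"
      by (subst tendsto_dist_iff)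
    then have "g (\<phi> x) = (\<lambda>k. d (\<phi> x k))"
      using LIMSEQ_imp_Cauchy[OF l] by (simp add: g_def fun_eq_iff)
    then show ?thesis using LIMSEQ_unique[OF conv[of "\<phi> x"]] l by simp
  qed
  then show ?thesis by (rule that[OF \<phi>m \<psi>])
qed

section \<open>From rectangles to duality\<close>

text \<open>The finite pieces are measured by \<mu>, not by \<open>M\<close> or \<open>N\<close>;
  their disjointness lets countable additivity glue the equalities together.\<close>

lemma measure_eqI_sigma_finite:
  assumes "sigma_finite_measure \<mu>" and sM: "sets M = sets \<mu>" and sN: "sets N = sets \<mu>"
    and eq: "\<And>B. B \<in> sets \<mu> \<Longrightarrow> emeasure \<mu> B \<noteq> \<infinity> \<Longrightarrow> emeasure M B = emeasure N B"
  shows "M = N"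
proof (rule measure_eqI)
  interpret sigma_finite_measure \<mu> by fact
  obtain F :: "nat \<Rightarrow> 'a set" where F: "range F \<subseteq> sets \<mu>" "(\<Union>i. F i) = space \<mu>"
    "\<And>i. emeasure \<mu> (F i) \<noteq> \<infinity>" "disjoint_family F"
    using sigma_finite_disjoint by blast
  fix B assume "B \<in> sets M"
  then have B: "B \<in> sets \<mu>" by (simp add: sM)
  have FB: "B \<inter> F i \<in> sets \<mu>" for i using F(1) B by auto
  have d: "disjoint_family (\<lambda>i. B \<inter> F i)"
    using F(4) by (auto simp: disjoint_family_on_def)
  have U: "(\<Union>i. B \<inter> F i) = B"
    using F(2) sets.sets_into_space[OF B] by auto
  have "emeasure M (B \<inter> F i) = emeasure N (B \<inter> F i)" for i
  proof (rule eq[OF FB])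
    have "emeasure \<mu> (B \<inter> F i) \<le> emeasure \<mu> (F i)"
      using F(1) by (intro emeasure_mono) auto
    then show "emeasure \<mu> (B \<inter> F i) \<noteq> \<infinity>" using F(3)[of i] by (auto simp: top_unique)
  qed
  then have "(\<Sum>i. emeasure M (B \<inter> F i)) = (\<Sum>i. emeasure N (B \<inter> F i))" by simp
  moreover have "(\<Sum>i. emeasure M (B \<inter> F i)) = emeasure M B"
    using suminf_emeasure[of "\<lambda>i. B \<inter> F i" M] FB d unfolding U by (auto simp: sM)
  moreover have "(\<Sum>i. emeasure N (B \<inter> F i)) = emeasure N B"
    using suminf_emeasure[of "\<lambda>i. B \<inter> F i" N] FB d unfolding U by (auto simp: sN)
  ultimately show "emeasure M B = emeasure N B" by simp
qed (simp add: sM sN)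

text \<open>Rectangles form an intersection-stable generator, and the strips
  \<open>F i \<times> UNIV\<close> exhaust the product with finite mass
  \<open>emeasure \<mu> (F i)\<close>.\<close>

lemma dual_kernelsI:
  assumes tk: "transition_kernel P" and tk': "transition_kernel P'"
    and sm: "sets \<mu> = sets borel" and sf: "sigma_finite_measure \<mu>"
    and rect: "\<And>C B. C \<in> sets borel \<Longrightarrow> B \<in> sets borel \<Longrightarrow>
      (\<integral>\<^sup>+x. indicator C x * emeasure (P x) B \<partial>\<mu>) = (\<integral>\<^sup>+y. indicator B y * emeasure (P' y) C \<partial>\<mu>)"
  shows "dual_kernels \<mu> P P'"
  unfolding dual_kernels_iff[OF tk tk' sm]
proof -
  interpret sigma_finite_measure \<mu> by (rule sf)
  obtain F :: "nat \<Rightarrow> 'a set" where F: "range F \<subseteq> sets \<mu>" "(\<Union>i. F i) = space \<mu>" "\<And>i. emeasure \<mu> (F i) \<noteq> \<infinity>"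
    using sigma_finite by blast
  have F': "F i \<in> sets borel" for i using F(1) sm by auto
  have swap: "prod.swap \<in> joint_measure \<mu> P' \<rightarrow>\<^sub>M borel \<Otimes>\<^sub>M borel"
    unfolding prod.swap_def measurable_cong_sets[OF sets_joint_measure[OF tk' sm] refl] by measurable
  have sp: "space (joint_measure \<mu> P') = UNIV"
    using sets_eq_imp_space_eq[OF sets_joint_measure[OF tk' sm]] by (simp add: space_pair_measure)
  have rectP: "emeasure (joint_measure \<mu> K) (C \<times> B) = (\<integral>\<^sup>+x. indicator C x * emeasure (K x) B \<partial>\<mu>)"
    if K: "transition_kernel K" and C: "C \<in> sets borel" and B: "B \<in> sets borel" for K and C B :: "'a set"
  proof -
    have "emeasure (K x) {y. (x, y) \<in> C \<times> B} = indicator C x * emeasure (K x) B" for x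
      by (cases "x \<in> C") auto
    then show ?thesis
      using emeasure_joint_measure[OF K sm, of "C \<times> B"] C B by simp
  qed
  let ?G = "{a \<times> b | a b. a \<in> sets (borel :: 'a measure) \<and> b \<in> sets (borel :: 'a measure)}"
  show "joint_measure \<mu> P = distr (joint_measure \<mu> P') (borel \<Otimes>\<^sub>M borel) prod.swap"
  proof (rule measure_eqI_generator_eq)
    show "Int_stable ?G" by (rule Int_stable_pair_measure_generator)
    show "?G \<subseteq> Pow UNIV" by simp
    show "sets (joint_measure \<mu> P) = sigma_sets UNIV ?G"
      using sets_pair_measure[of "borel :: 'a measure" "borel :: 'a measure"]
      by (simp add: sets_joint_measure[OF tk sm])
    show "sets (distr (joint_measure \<mu> P') (borel \<Otimes>\<^sub>M borel) prod.swap) = sigma_sets UNIV ?G"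
      using sets_pair_measure[of "borel :: 'a measure" "borel :: 'a measure"] by simp
    show "emeasure (joint_measure \<mu> P) X = emeasure (distr (joint_measure \<mu> P') (borel \<Otimes>\<^sub>M borel) prod.swap) X"
      if X': "X \<in> ?G" for X
    proof -
      obtain C B where X: "X = C \<times> B" and C: "C \<in> sets borel" and B: "B \<in> sets borel"
        using X' by blast
      have sX: "X \<in> sets (borel \<Otimes>\<^sub>M borel)" unfolding X using C B by simp
      have "prod.swap -` X \<inter> UNIV = B \<times> C" by (auto simp: X)
      then have "emeasure (distr (joint_measure \<mu> P') (borel \<Otimes>\<^sub>M borel) prod.swap) X =
          (\<integral>\<^sup>+y. indicator B y * emeasure (P' y) C \<partial>\<mu>)"
        unfolding emeasure_distr[OF swap sX] sp by (simp only: rectP[OF tk' B C])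
      then show ?thesis
        unfolding X rectP[OF tk C B] rect[OF C B] by simp
    qed
    show "range (\<lambda>i. F i \<times> UNIV) \<subseteq> ?G"
      by (intro image_subsetI CollectI exI conjI) (rule refl, auto simp: F')
    show "(\<Union>i. F i \<times> UNIV) = (UNIV :: ('a \<times> 'a) set)"
      using F(2) unfolding space_mu[OF sm] by auto
    have one: "emeasure (P x) UNIV = 1" for x
      using prob_space.emeasure_space_1[OF transition_kernelD(2)[OF tk]] by (simp add: transition_kernelD(4)[OF tk])
    show "emeasure (joint_measure \<mu> P) (F i \<times> UNIV) \<noteq> \<infinity>" for i
      using F(3)[of i] F'[of i] by (simp add: rectP[OF tk] one sm)
  qed
qed

lemma ex_dual_kernel:
  fixes P :: "'a::polish_space \<Rightarrow> 'a measure"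
  assumes tk: "transition_kernel P" and sm: "sets \<mu> = sets borel" and sf: "sigma_finite_measure \<mu>"
    and inv: "invariant_measure (\<lambda>x B. emeasure (P x) B) \<mu>"
  shows "\<exists>P'. transition_kernel P' \<and> dual_kernels \<mu> P P'"
proof -
  interpret sigma_finite_measure \<mu> by (rule sf)
  note [measurable_cong] = sm
  have sp: "space \<mu> = UNIV" by (rule space_mu[OF sm])
  obtain \<phi> :: "'a \<Rightarrow> nat \<Rightarrow> nat" and \<psi> where \<phi>[measurable]: "\<phi> \<in> borel \<rightarrow>\<^sub>M digit_space"
    and \<psi>[measurable]: "\<psi> \<in> digit_space \<rightarrow>\<^sub>M borel" and \<psi>\<phi>: "\<And>x. \<psi> (\<phi> x) = x"
    by (rule polish_coding) blast
  define c where "c s x = (indicator (prefix_set s) (\<phi> x) :: ennreal)" for s x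
  have c[measurable]: "c s \<in> borel_measurable borel" for s
    unfolding c_def[abs_def] by measurable
  have Pm: "(\<lambda>x. emeasure (P x) B) \<in> borel_measurable borel" if B: "B \<in> sets borel" for B
    by (rule measurable_compose[OF transition_kernelD(1)[OF tk] measurable_emeasure_subprob_algebra[OF B]])
  have inv': "(\<integral>\<^sup>+x. emeasure (P x) B \<partial>\<mu>) = emeasure \<mu> B" if "B \<in> sets borel" for B
    using inv that sm by (simp add: invariant_measure_def)
  \<comment> \<open>\<open>\<nu> s\<close> is the law of the state at time 1, under \<mu>, on the
    event that the code of the state at time 0 begins with \<open>s\<close>.\<close>
  define \<nu> where "\<nu> s = density \<mu> (c s) \<bind> P" for s
  have s\<nu>: "sets (\<nu> s) = sets borel" for s
    unfolding \<nu>_def by (rule sets_kernel_bind) (simp_all add: sm transition_kernelD(3)[OF tk])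
  have \<nu>: "emeasure (\<nu> s) B = (\<integral>\<^sup>+x. c s x * emeasure (P x) B \<partial>\<mu>)" if B: "B \<in> sets borel" for s B
    unfolding \<nu>_def by (rule emeasure_density_bind[OF sm c transition_kernelD(1)[OF tk] B])
  have "\<exists>f\<in>borel_measurable \<mu>. density \<mu> f = \<nu> s" for s
  proof (rule Radon_Nikodym)
    show "absolutely_continuous \<mu> (\<nu> s)"
      unfolding absolutely_continuous_def
    proof
      fix N assume N: "N \<in> null_sets \<mu>"
      then have NB: "N \<in> sets borel" using sm by auto
      \<comment> \<open>Dropping the condition on the code leaves the law at time 1, which is \<mu>
        by invariance; hence the densities exist.\<close>
      have "emeasure (\<nu> s) N \<le> (\<integral>\<^sup>+x. emeasure (P x) N \<partial>\<mu>)"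
        unfolding \<nu>[OF NB] by (intro nn_integral_mono) (auto simp: c_def split: split_indicator)
      then show "N \<in> null_sets (\<nu> s)"
        using N NB by (auto simp: inv' null_sets_def s\<nu>)
    qed
  qed (simp add: s\<nu> sm)
  then obtain f where f: "\<And>s. f s \<in> borel_measurable \<mu>" and df: "\<And>s. density \<mu> (f s) = \<nu> s"
    by metis
  note [measurable] = f
  have f_int: "(\<integral>\<^sup>+y. indicator B y * f s y \<partial>\<mu>) = (\<integral>\<^sup>+x. c s x * emeasure (P x) B \<partial>\<mu>)"
    if B: "B \<in> sets borel" for s B
    using emeasure_density[OF f, of B s] B by (simp add: df \<nu> sm mult.commute)
  have good1: "AE y in \<mu>. f [] y = 1"
  proof (rule density_unique)
    show "density \<mu> (f []) = density \<mu> (\<lambda>_. 1)"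
      unfolding df
      by (rule measure_eqI) (auto simp: s\<nu> sm \<nu> c_def inv' emeasure_density)
  qed auto
  have good2: "AE y in \<mu>. (\<Sum>j. f (s @ [j]) y) = f s y" for s
  proof (rule density_unique)
    show "density \<mu> (\<lambda>y. \<Sum>j. f (s @ [j]) y) = density \<mu> (f s)"
    proof (rule measure_eqI)
      fix B assume "B \<in> sets (density \<mu> (\<lambda>y. \<Sum>j. f (s @ [j]) y))"
      then have B[measurable]: "B \<in> sets borel" by (simp add: sm)
      note [measurable] = Pm[OF B]
      \<comment> \<open>Exactly one digit, \<open>\<phi> x (length s)\<close>, extends a prefix of
        the code of \<open>x\<close>.\<close>
      have csum: "(\<Sum>j. c (s @ [j]) x) = c s x" for x
      proof -
        have "(\<Sum>j. c (s @ [j]) x) = (\<Sum>j\<in>{\<phi> x (length s)}. c (s @ [j]) x)"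
          by (rule suminf_finite) (auto simp: c_def prefix_set_snoc)
        then show ?thesis by (simp add: c_def prefix_set_snoc indicator_def)
      qed
      have "emeasure (density \<mu> (\<lambda>y. \<Sum>j. f (s @ [j]) y)) B = (\<integral>\<^sup>+y. (\<Sum>j. f (s @ [j]) y) * indicator B y \<partial>\<mu>)"
        by (rule emeasure_density) (auto simp: sm)
      also have "\<dots> = (\<integral>\<^sup>+y. (\<Sum>j. indicator B y * f (s @ [j]) y) \<partial>\<mu>)"
        by (simp add: mult.commute)
      also have "\<dots> = (\<Sum>j. \<integral>\<^sup>+y. indicator B y * f (s @ [j]) y \<partial>\<mu>)"
        by (rule nn_integral_suminf) measurable
      also have "\<dots> = (\<Sum>j. \<integral>\<^sup>+x. c (s @ [j]) x * emeasure (P x) B \<partial>\<mu>)"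
        by (simp only: f_int[OF B])
      also have "\<dots> = (\<integral>\<^sup>+x. (\<Sum>j. c (s @ [j]) x * emeasure (P x) B) \<partial>\<mu>)"
        by (rule nn_integral_suminf[symmetric]) measurable
      also have "\<dots> = (\<integral>\<^sup>+x. c s x * emeasure (P x) B \<partial>\<mu>)"
        by (simp only: ennreal_suminf_multc csum)
      finally show "emeasure (density \<mu> (\<lambda>y. \<Sum>j. f (s @ [j]) y)) B = emeasure (density \<mu> (f s)) B"
        by (simp add: df \<nu>[OF B])
    qed simp
  qed auto
  \<comment> \<open>The weights of the point mass at the zero sequence, the default law where the
    densities are inconsistent.\<close>
  define w0 :: "nat list \<Rightarrow> ennreal" where "w0 s = (if set s \<subseteq> {0} then 1 else 0)" for s
  have w0: "prefix_weights w0"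
    unfolding prefix_weights_def
  proof (intro conjI allI)
    fix s :: "nat list"
    have "(\<Sum>j. w0 (s @ [j])) = (\<Sum>j\<in>{0}. w0 (s @ [j]))"
      by (rule suminf_finite) (auto simp: w0_def)
    then show "(\<Sum>j. w0 (s @ [j])) = w0 s" by (simp add: w0_def)
  qed (simp add: w0_def)
  define w where "w y s = (if prefix_weights (\<lambda>s. f s y) then f s y else w0 s)" for y s
  have "prefix_weights (w y)" for y
    by (cases "prefix_weights (\<lambda>s. f s y)") (simp_all add: w_def[abs_def] w0)
  from prefix_weights_measure[OF this]
  obtain Q where Q: "\<And>y. prob_space (Q y)" "\<And>y. sets (Q y) = sets digit_space"
    "\<And>y s. emeasure (Q y) (prefix_set s) = w y s"
    by metis
  have wm: "(\<lambda>y. w y s) \<in> borel_measurable borel" for s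
  proof -
    have "(\<lambda>y. w y s) \<in> borel_measurable \<mu>"
      unfolding w_def prefix_weights_def by measurable
    then show ?thesis by (simp add: measurable_cong_sets[OF sm refl])
  qed
  have Qk: "Q \<in> borel \<rightarrow>\<^sub>M prob_algebra digit_space"
    by (rule measurable_prob_algebra_generated[OF sets_digit_space Int_stable_prefix_sets])
       (auto simp: Q wm)
  define P' where "P' y = distr (Q y) borel \<psi>" for y
  have tk': "transition_kernel P'"
    unfolding transition_kernel_def P'_def[abs_def]
    by (rule measurable_compose[OF Qk measurable_distr_prob_space[OF \<psi>]])
  have P'm: "(\<lambda>y. emeasure (P' y) C) \<in> borel_measurable borel" if C: "C \<in> sets borel" for C
    by (rule measurable_compose[OF transition_kernelD(1)[OF tk'] measurable_emeasure_subprob_algebra[OF C]])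
  have wf: "AE y in \<mu>. w y s = f s y" for s
  proof -
    have "AE y in \<mu>. \<forall>s. (\<Sum>j. f (s @ [j]) y) = f s y"
      unfolding AE_all_countable using good2 by blast
    with good1 show ?thesis
      by eventually_elim (simp add: w_def prefix_weights_def)
  qed
  \<comment> \<open>Finite mass of \<open>B\<close> makes both measures on digit sequences finite,
    so that they coincide once they agree on prefix sets.\<close>
  have rect_fin: "(\<integral>\<^sup>+x. indicator C x * emeasure (P x) B \<partial>\<mu>) = (\<integral>\<^sup>+y. indicator B y * emeasure (P' y) C \<partial>\<mu>)"
    if C[measurable]: "C \<in> sets borel" and B[measurable]: "B \<in> sets borel" and fin: "emeasure \<mu> B \<noteq> \<infinity>" for C B
  proof -
    note [measurable] = Pm[OF B]
    let ?N1 = "distr (density \<mu> (\<lambda>x. emeasure (P x) B)) digit_space \<phi>"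
    let ?N2 = "density \<mu> (indicator B) \<bind> Q"
    have sN2: "sets ?N2 = sets digit_space"
      by (rule sets_kernel_bind) (simp_all add: sm Q)
    have N1: "emeasure ?N1 D = (\<integral>\<^sup>+x. indicator D (\<phi> x) * emeasure (P x) B \<partial>\<mu>)"
      if D[measurable]: "D \<in> sets digit_space" for D
    proof -
      have "\<phi> \<in> density \<mu> (\<lambda>x. emeasure (P x) B) \<rightarrow>\<^sub>M digit_space" by measurable
      moreover have "\<phi> -` D \<in> sets \<mu>"
        using measurable_sets[OF \<phi> D] by (simp add: sm)
      ultimately show ?thesis
        by (simp add: emeasure_distr sp emeasure_density) (auto intro!: nn_integral_cong split: split_indicator)
    qed
    have N2: "emeasure ?N2 D = (\<integral>\<^sup>+y. indicator B y * emeasure (Q y) D \<partial>\<mu>)" if D: "D \<in> sets digit_space" for D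
      by (rule emeasure_density_bind[OF sm _ measurable_prob_algebraD[OF Qk] D]) measurable
    have pre: "emeasure ?N1 (prefix_set s) = emeasure ?N2 (prefix_set s)" for s
    proof -
      have "(\<integral>\<^sup>+y. indicator B y * w y s \<partial>\<mu>) = (\<integral>\<^sup>+y. indicator B y * f s y \<partial>\<mu>)"
        using wf[of s] by (intro nn_integral_cong_AE) auto
      then show ?thesis
        unfolding N1[OF sets_prefix_set] N2[OF sets_prefix_set] by (simp add: f_int[OF B] c_def Q)
    qed
    have eq: "?N1 = ?N2"
    proof (rule measure_eqI_generator_eq[OF Int_stable_prefix_sets])
      show "range (\<lambda>_::nat. prefix_set []) \<subseteq> insert {} (range prefix_set)" by blast
      show "emeasure ?N1 (prefix_set []) \<noteq> \<infinity>"
        unfolding N1[OF sets_prefix_set] using fin by (simp add: inv'[OF B])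
      show "emeasure ?N1 X = emeasure ?N2 X" if "X \<in> insert {} (range prefix_set)" for X
        using that pre by auto
      show "sets ?N1 = sigma_sets UNIV (insert {} (range prefix_set))"
        using sets_digit_space by simp
      show "sets ?N2 = sigma_sets UNIV (insert {} (range prefix_set))"
        using sN2 sets_digit_space by simp
    qed auto
    have D: "\<psi> -` C \<in> sets digit_space"
      using measurable_sets[OF \<psi> C] by simp
    have P'C: "emeasure (P' y) C = emeasure (Q y) (\<psi> -` C)" for y
    proof -
      have "\<psi> \<in> Q y \<rightarrow>\<^sub>M borel" by (simp add: measurable_cong_sets[OF Q(2) refl])
      moreover have "space (Q y) = UNIV" using sets_eq_imp_space_eq[OF Q(2)] by simp
      ultimately show ?thesis unfolding P'_def by (simp add: emeasure_distr C)
    qed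
    \<comment> \<open>Decoding undoes coding, so the code of \<open>x\<close> lies in the preimage
      of \<open>C\<close> exactly when \<open>x\<close> lies in \<open>C\<close>.\<close>
    have "(\<integral>\<^sup>+x. indicator C x * emeasure (P x) B \<partial>\<mu>) = emeasure ?N1 (\<psi> -` C)"
      unfolding N1[OF D] by (simp add: indicator_def \<psi>\<phi>)
    then show ?thesis
      unfolding eq N2[OF D] P'C .
  qed
  have "dual_kernels \<mu> P P'"
  proof (rule dual_kernelsI[OF tk tk' sm sf])
    fix C B :: "'a set" assume C[measurable]: "C \<in> sets borel" and B: "B \<in> sets borel"
    let ?M = "density \<mu> (indicator C) \<bind> P" and ?N = "density \<mu> (\<lambda>y. emeasure (P' y) C)"
    note [measurable] = P'm[OF C]
    have M: "emeasure ?M B = (\<integral>\<^sup>+x. indicator C x * emeasure (P x) B \<partial>\<mu>)" if B: "B \<in> sets borel" for B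
      by (rule emeasure_density_bind[OF sm _ transition_kernelD(1)[OF tk] B]) measurable
    have N: "emeasure ?N B = (\<integral>\<^sup>+y. indicator B y * emeasure (P' y) C \<partial>\<mu>)" if B: "B \<in> sets borel" for B
      using B by (subst emeasure_density) (auto simp: sm mult.commute)
    \<comment> \<open>With \<open>C\<close> fixed, both sides are measures in \<open>B\<close>,
      which removes the finiteness assumption on \<open>B\<close>.\<close>
    have "?M = ?N"
    proof (rule measure_eqI_sigma_finite[OF sf])
      show "sets ?M = sets \<mu>"
        unfolding sm by (rule sets_kernel_bind) (simp_all add: sm transition_kernelD(3)[OF tk])
      fix B assume B': "B \<in> sets \<mu>" and fin: "emeasure \<mu> B \<noteq> \<infinity>"
      have B: "B \<in> sets borel" using B' by (simp add: sm)
      show "emeasure ?M B = emeasure ?N B"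
        unfolding M[OF B] N[OF B] by (rule rect_fin[OF C B fin])
    qed simp
    then show "(\<integral>\<^sup>+x. indicator C x * emeasure (P x) B \<partial>\<mu>) = (\<integral>\<^sup>+y. indicator B y * emeasure (P' y) C \<partial>\<mu>)"
      unfolding M[OF B, symmetric] N[OF B, symmetric] by simp
  qed
  with tk' show ?thesis by blast
qed

theorem theorem4p1:
  fixes P :: "'a::polish_space \<Rightarrow> 'a measure" and \<mu> :: "'a measure"
  assumes "transition_kernel P"
    and "sets \<mu> = sets borel"
    and "sigma_finite_measure \<mu>"
    and "invariant_measure (\<lambda>x B. emeasure (P x) B) \<mu>"
  shows "(\<exists>P'. transition_kernel P' \<and> dual_kernels \<mu> P P') \<and>
    (\<forall>P' A. transition_kernel P' \<and> dual_kernels \<mu> P P' \<and> A \<in> sets borel \<and>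
        emeasure (chain_law_from P (restrict_space \<mu> A)) {\<omega>. hit_time (- A) \<omega> = \<infinity>} = 0 \<and>
        emeasure (chain_law_from P (restrict_space \<mu> (- A))) {\<omega>. hit_time A \<omega> = \<infinity>} = 0 \<and>
        emeasure (chain_law_from P' (restrict_space \<mu> A)) {\<omega>. hit_time (- A) \<omega> = \<infinity>} = 0 \<and>
        emeasure (chain_law_from P' (restrict_space \<mu> (- A))) {\<omega>. hit_time A \<omega> = \<infinity>} = 0
      \<longrightarrow>
        proper_entr P A (mu_entr P \<mu> A) \<and> invariant_entr P A (mu_entr P \<mu> A) \<and>
        proper_exit P A (mu_exit P \<mu> A) \<and> invariant_exit P A (mu_exit P \<mu> A) \<and>
        mu_entr P \<mu> A = density (restrict_space \<mu> A) (\<lambda>x. emeasure (P' x) (- A)) \<and>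
        (\<forall>B\<in>sets borel.
           emeasure \<mu> B =
             (\<integral>\<^sup>+\<omega>. (\<Sum>k. indicator {k. enat k < entr_time A 1 \<omega>} k * indicator B (\<omega> k))
                \<partial>chain_law_from P (mu_entr P \<mu> A))))"
proof (rule conjI)
  show "\<exists>P'. transition_kernel P' \<and> dual_kernels \<mu> P P'"
    by (rule ex_dual_kernel[OF assms])
next
  show "\<forall>P' A. transition_kernel P' \<and> dual_kernels \<mu> P P' \<and> A \<in> sets borel \<and>
        emeasure (chain_law_from P (restrict_space \<mu> A)) {\<omega>. hit_time (- A) \<omega> = \<infinity>} = 0 \<and>
        emeasure (chain_law_from P (restrict_space \<mu> (- A))) {\<omega>. hit_time A \<omega> = \<infinity>} = 0 \<and>
        emeasure (chain_law_from P' (restrict_space \<mu> A)) {\<omega>. hit_time (- A) \<omega> = \<infinity>} = 0 \<and>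
        emeasure (chain_law_from P' (restrict_space \<mu> (- A))) {\<omega>. hit_time A \<omega> = \<infinity>} = 0
      \<longrightarrow>
        proper_entr P A (mu_entr P \<mu> A) \<and> invariant_entr P A (mu_entr P \<mu> A) \<and>
        proper_exit P A (mu_exit P \<mu> A) \<and> invariant_exit P A (mu_exit P \<mu> A) \<and>
        mu_entr P \<mu> A = density (restrict_space \<mu> A) (\<lambda>x. emeasure (P' x) (- A)) \<and>
        (\<forall>B\<in>sets borel.
           emeasure \<mu> B =
             (\<integral>\<^sup>+\<omega>. (\<Sum>k. indicator {k. enat k < entr_time A 1 \<omega>} k * indicator B (\<omega> k))
                \<partial>chain_law_from P (mu_entr P \<mu> A)))"
  proof (rule allI, rule allI, rule impI, elim conjE)
    fix P' :: "'a \<Rightarrow> 'a measure" and A :: "'a set"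
    assume tk': "transition_kernel P'" and dual: "dual_kernels \<mu> P P'" and A: "A \<in> sets borel"
      and h: "emeasure (chain_law_from P (restrict_space \<mu> A)) {\<omega>. hit_time (- A) \<omega> = \<infinity>} = 0"
        "emeasure (chain_law_from P (restrict_space \<mu> (- A))) {\<omega>. hit_time A \<omega> = \<infinity>} = 0"
      and h': "emeasure (chain_law_from P' (restrict_space \<mu> A)) {\<omega>. hit_time (- A) \<omega> = \<infinity>} = 0"
        "emeasure (chain_law_from P' (restrict_space \<mu> (- A))) {\<omega>. hit_time A \<omega> = \<infinity>} = 0"
    interpret dual_chains P P' \<mu>
      by (rule dual_chains.intro[OF assms(1) tk' assms(2,3) dual])
    \<comment> \<open>Oscillation is needed for both chains. For the dual one, the invariance of
      \<mu> comes from duality with constants; for the original one, it is turned into recurrence of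
      almost every state.\<close>
    note osc = AE_oscillates[OF tk' sets_mu invariant_measure_dual A h']
    note rec = AE_recurrent_states[OF tk sets_mu A AE_oscillates[OF tk sets_mu assms(4) A h]]
    show "proper_entr P A (mu_entr P \<mu> A) \<and> invariant_entr P A (mu_entr P \<mu> A) \<and>
        proper_exit P A (mu_exit P \<mu> A) \<and> invariant_exit P A (mu_exit P \<mu> A) \<and>
        mu_entr P \<mu> A = density (restrict_space \<mu> A) (\<lambda>x. emeasure (P' x) (- A)) \<and>
        (\<forall>B\<in>sets borel.
           emeasure \<mu> B =
             (\<integral>\<^sup>+\<omega>. (\<Sum>k. indicator {k. enat k < entr_time A 1 \<omega>} k * indicator B (\<omega> k))
                \<partial>chain_law_from P (mu_entr P \<mu> A)))"
      by (intro conjI ballI proper_entr_mu_entr[OF A rec] invariant_entr_mu_entr[OF A osc]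
        proper_exit_mu_exit[OF A rec] invariant_exit_mu_exit[OF A osc]
        mu_entr_eq_density[OF A] occupation_formula[OF A _ osc])
  qed
qed

end
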